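(* Let $(R,\mathfrak m,k)$ be a local Artinian ring which is the factor of a local Artinian Gorenstein ring by its socle. Let $\omega$ be the canonical module of $R$. Then $R$ satisfies all of the following conditions: (1) $\mathfrak m\subseteq \omega^*(\omega)$. (2) For all ideals $K$ generated by a system of parameters and for all ideals $I\supseteq K$, $K:(K:I)\subseteq I:\mathfrak m$. (3) For all $K$ generated by a system of parameters whose members are not contained in any prime of a given finite (or countable, if $R$ is complete or $k$ is uncountable) set of primes not equal to the maximal ideal, and for all ideals $I\supseteq K$, $K:(K:I)\subseteq I:\mathfrak m$. (Since $R$ is Artinian, the only ideal $K$ generated by a system of parameters is $K=0$, so (2) and (3) both say that $0:(0:I)\subseteq I:\mathfrak m$ for all ideals $I$ of $R$.)
   Context: All rings are commutative and Noetherian. For an $R$-module $M$, $M^*=\operatorname{Hom}_R(M,R)$, and $M^*(M)$ is the ideal of $R$ generated by all elements $f(x)$ with $x\in M$ and $f\in M^*$. All colon ideals are taken in $R$. For $R$ Artinian local, $\omega$ is the injective hull of $k$. The socle of a local ring $(A,\mathfrak n)$ is $0:_A\mathfrak n$. *)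

theory Defs
  imports "HOL-Algebra.Ideal_Product" "HOL-Algebra.Ring_Divisibility" "HOL-Algebra.QuotRing"
    "HOL-Library.Extended_Nat" "HOL-Library.Countable_Set"
begin

section \<open>Local and Artinian rings\<close>

text \<open>Noetherianity is a standing assumption on all rings, hence part of the definition.\<close>

locale local_ring = cring R + noetherian_ring R + maximalideal \<mm> R
  for \<mm> and R (structure) +
  assumes unique_maximalideal: "maximalideal \<nn> R \<Longrightarrow> \<nn> = \<mm>"

locale artinian_local_ring = local_ring +
  assumes descending_chain_condition:
    "\<lbrakk>\<And>n::nat. ideal (I n) R; \<And>n. I (Suc n) \<subseteq> I n\<rbrakk> \<Longrightarrow> \<exists>N. \<forall>n\<ge>N. I n = I N"

definition colon_ideal :: "('a, 'r) ring_scheme \<Rightarrow> 'a set \<Rightarrow> 'a set \<Rightarrow> 'a set"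
  where "colon_ideal R I J = {r \<in> carrier R. \<forall>x\<in>J. r \<otimes>\<^bsub>R\<^esub> x \<in> I}"

definition socle :: "('a, 'r) ring_scheme \<Rightarrow> 'a set \<Rightarrow> 'a set"
  where "socle R \<mm> = colon_ideal R {\<zero>\<^bsub>R\<^esub>} \<mm>"

section \<open>Modules\<close>

text \<open>The \<open>mult\<close> and \<open>one\<close> fields of the records below are not used in the module structure.\<close>

definition self_module :: "('a, 'r) ring_scheme \<Rightarrow> ('a, 'a) module"
  where "self_module R =
    \<lparr>carrier = carrier R, monoid.mult = (\<otimes>\<^bsub>R\<^esub>), one = \<one>\<^bsub>R\<^esub>, ring.zero = \<zero>\<^bsub>R\<^esub>, ring.add = (\<oplus>\<^bsub>R\<^esub>),
     smult = (\<otimes>\<^bsub>R\<^esub>)\<rparr>"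

definition quotient_module :: "('a, 'r) ring_scheme \<Rightarrow> 'a set \<Rightarrow> ('a, 'a set) module"
  where "quotient_module R I =
    \<lparr>carrier = carrier (R Quot I), monoid.mult = (\<otimes>\<^bsub>R Quot I\<^esub>), one = \<one>\<^bsub>R Quot I\<^esub>,
     ring.zero = \<zero>\<^bsub>R Quot I\<^esub>, ring.add = (\<oplus>\<^bsub>R Quot I\<^esub>),
     smult = (\<lambda>r C. (I +>\<^bsub>R\<^esub> r) \<otimes>\<^bsub>R Quot I\<^esub> C)\<rparr>"

definition module_hom ::
    "('a, 'r) ring_scheme \<Rightarrow> ('a, 'b, 'm) module_scheme \<Rightarrow> ('a, 'c, 'n) module_scheme \<Rightarrow> ('b \<Rightarrow> 'c) set"
  where "module_hom R M N =
    {f \<in> carrier M \<rightarrow> carrier N.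
       (\<forall>x\<in>carrier M. \<forall>y\<in>carrier M. f (x \<oplus>\<^bsub>M\<^esub> y) = f x \<oplus>\<^bsub>N\<^esub> f y) \<and>
       (\<forall>r\<in>carrier R. \<forall>x\<in>carrier M. f (r \<odot>\<^bsub>M\<^esub> x) = r \<odot>\<^bsub>N\<^esub> f x)}"

text \<open>The ideal \<open>M\<^sup>*(M)\<close>, where \<open>M\<^sup>* = Hom\<^sub>R(M, R)\<close>.\<close>

definition trace_ideal :: "('a, 'r) ring_scheme \<Rightarrow> ('a, 'b, 'm) module_scheme \<Rightarrow> 'a set"
  where "trace_ideal R M = Idl\<^bsub>R\<^esub> {f x | f x. f \<in> module_hom R M (self_module R) \<and> x \<in> carrier M}"

section \<open>Injective modules and Gorenstein rings\<close>

text \<open>The test modules \<open>A\<close> and \<open>B\<close> range over the \<open>R\<close>-modules whose elements are of the same type as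
  those of \<open>R\<close>. This is no restriction: it covers the inclusions of ideals into \<open>R\<close>, so that by
  Baer's criterion the lifting property holds for test modules over any types.\<close>

definition injective_module :: "('a, 'r) ring_scheme \<Rightarrow> ('a, 'e, 'm) module_scheme \<Rightarrow> bool"
  where "injective_module R E \<longleftrightarrow>
    module R E \<and>
    (\<forall>(A :: ('a, 'a) module) (B :: ('a, 'a) module) i f.
       module R A \<and> module R B \<and> i \<in> module_hom R A B \<and> inj_on i (carrier A) \<and> f \<in> module_hom R A E
       \<longrightarrow> (\<exists>g \<in> module_hom R B E. \<forall>x\<in>carrier A. g (i x) = f x))"

definition is_injective_hull ::
    "('a, 'r) ring_scheme \<Rightarrow> ('a, 'b, 'm) module_scheme \<Rightarrow> ('a, 'e, 'n) module_scheme \<Rightarrow> bool"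
  where "is_injective_hull R M E \<longleftrightarrow>
    injective_module R E \<and>
    (\<exists>i \<in> module_hom R M E. inj_on i (carrier M) \<and>
       (\<forall>N. submodule N R E \<and> N \<inter> i ` carrier M = {\<zero>\<^bsub>E\<^esub>} \<longrightarrow> N = {\<zero>\<^bsub>E\<^esub>}))"

text \<open>\<open>M\<close> has an injective resolution
  \<open>0 \<rightarrow> M \<rightarrow> E 0 \<rightarrow> E 1 \<rightarrow> \<dots> \<rightarrow> E n \<rightarrow> 0\<close>.\<close>

definition finite_injective_dimension :: "('a, 'r) ring_scheme \<Rightarrow> ('a, 'b) module \<Rightarrow> bool"
  where "finite_injective_dimension R M \<longleftrightarrow>
    (\<exists>(n::nat) (E :: nat \<Rightarrow> ('a, 'b) module) \<epsilon> d.
       (\<forall>i. injective_module R (E i)) \<and>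
       (\<forall>i>n. carrier (E i) = {\<zero>\<^bsub>E i\<^esub>}) \<and>
       \<epsilon> \<in> module_hom R M (E 0) \<and> inj_on \<epsilon> (carrier M) \<and>
       (\<forall>i. d i \<in> module_hom R (E i) (E (Suc i))) \<and>
       \<epsilon> ` carrier M = {x \<in> carrier (E 0). d 0 x = \<zero>\<^bsub>E 1\<^esub>} \<and>
       (\<forall>i. d i ` carrier (E i) = {x \<in> carrier (E (Suc i)). d (Suc i) x = \<zero>\<^bsub>E (Suc (Suc i))\<^esub>}))"

text \<open>The terms of the resolution have elements of the same type as those of \<open>R\<close>. For an Artinian
  local ring this is no restriction, as the ring is of finite injective dimension over itself if and
  only if it is self-injective.\<close>

locale gorenstein_local_ring = local_ring +
  assumes finite_injective_dimension: "finite_injective_dimension R (self_module R)"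

section \<open>Systems of parameters and completeness\<close>

definition krull_dim :: "('a, 'r) ring_scheme \<Rightarrow> enat"
  where "krull_dim R =
    Sup {enat n | n. \<exists>P. (\<forall>i\<le>n. primeideal (P i) R) \<and> (\<forall>i<n. P i \<subset> P (Suc i))}"

definition system_of_parameters :: "('a, 'r) ring_scheme \<Rightarrow> 'a set \<Rightarrow> 'a list \<Rightarrow> bool"
  where "system_of_parameters R \<mm> xs \<longleftrightarrow>
    enat (length xs) = krull_dim R \<and> set xs \<subseteq> \<mm> \<and>
    (\<exists>n::nat. \<mm> [^]\<^bsub>ideals_set R\<^esub> n \<subseteq> Idl\<^bsub>R\<^esub> (set xs))"

definition adic_complete :: "('a, 'r) ring_scheme \<Rightarrow> 'a set \<Rightarrow> bool"
  where "adic_complete R \<mm> \<longleftrightarrow>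
    (\<Inter>n::nat. \<mm> [^]\<^bsub>ideals_set R\<^esub> n) = {\<zero>\<^bsub>R\<^esub>} \<and>
    (\<forall>x :: nat \<Rightarrow> 'a. range x \<subseteq> carrier R \<and>
        (\<forall>n::nat. \<exists>N. \<forall>i\<ge>N. \<forall>j\<ge>N. x i \<ominus>\<^bsub>R\<^esub> x j \<in> \<mm> [^]\<^bsub>ideals_set R\<^esub> n)
      \<longrightarrow> (\<exists>l\<in>carrier R. \<forall>n::nat. \<exists>N. \<forall>i\<ge>N. x i \<ominus>\<^bsub>R\<^esub> l \<in> \<mm> [^]\<^bsub>ideals_set R\<^esub> n))"

end

theory Submission
  imports Defs
begin

text \<open>Let \<open>R = S / soc S\<close>. An Artinian local ring of finite injective dimension is self-injective,
  since \<open>k\<close> embeds into it; so \<open>0 : (0 : J) = J\<close> for all ideals \<open>J\<close> of \<open>S\<close>.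

  Let \<open>J\<close> be the preimage of \<open>I\<close> and let \<open>x \<in> S\<close> represent an element of \<open>0 : (0 : I)\<close>. If \<open>s J = 0\<close>,
  then \<open>s x \<in> soc S\<close>, so \<open>s x \<nn> = 0\<close>. Hence \<open>x \<nn> \<subseteq> 0 : (0 : J) = J\<close>.

  The injective hull of \<open>k\<close> over \<open>R\<close> is \<open>Hom\<^sub>S(R, S) = 0 : soc S = \<nn>\<close>, and the projection
  \<open>\<nn> \<rightarrow> \<nn> / soc S = \<mm>\<close> is a homomorphism from it to \<open>R\<close> with image \<open>\<mm>\<close>.\<close>

section \<open>Homomorphisms from ideals and Baer's criterion\<close>

text \<open>Uniqueness of injective hulls does not apply directly: \<open>\<omega>\<close> is an
  arbitrary hull whose elements have a type of their own, whereas \<open>injective_module\<close>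
  tests only modules over the element type of the ring. Baer's criterion speaks of ideals alone and
  is independent of types, so injectivity is always used in that form, and maps out of ideals are
  extended by one generator at a time. The ascending chain condition then provides maximal domains
  and replaces induction on length. The recurring resource is a copy of the residue field in every
  nonzero quotient R/I: an element whose annihilator is exactly the maximal ideal.\<close>

abbreviation ideal_module :: "('a, 'r) ring_scheme \<Rightarrow> 'a set \<Rightarrow> ('a, 'a) module"
  where "ideal_module R I \<equiv> (self_module R)\<lparr>carrier := I\<rparr>"

text \<open>The extension of \<open>f\<close> to the whole ring is recorded by the image
  \<open>y\<close> of 1.\<close>

definition baer_injective :: "('a, 'r) ring_scheme \<Rightarrow> ('a, 'e, 'm) module_scheme \<Rightarrow> bool"
  where "baer_injective R E \<longleftrightarrow>
    (\<forall>I f. ideal I R \<and> f \<in> module_hom R (ideal_module R I) E \<longrightarrow>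
      (\<exists>y\<in>carrier E. \<forall>r\<in>I. f r = r \<odot>\<^bsub>E\<^esub> y))"

lemma module_hom_ideal_iff:
  "f \<in> module_hom R (ideal_module R I) M \<longleftrightarrow>
    f \<in> I \<rightarrow> carrier M \<and> (\<forall>x\<in>I. \<forall>y\<in>I. f (x \<oplus>\<^bsub>R\<^esub> y) = f x \<oplus>\<^bsub>M\<^esub> f y) \<and>
    (\<forall>r\<in>carrier R. \<forall>x\<in>I. f (r \<otimes>\<^bsub>R\<^esub> x) = r \<odot>\<^bsub>M\<^esub> f x)"
  by (simp add: module_hom_def self_module_def)

lemma (in cring) self_module: "module R (self_module R)"
proof (rule moduleI)
  show "abelian_group (self_module R)"
    by (rule abelian_groupI)
      (auto simp: self_module_def a_ac intro: l_neg)
qed (auto simp: self_module_def cring_axioms l_distr r_distr m_assoc)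

lemma (in cring) ideal_module: "ideal I R \<Longrightarrow> module R (ideal_module R I)"
proof -
  assume "ideal I R"
  then interpret I: ideal I R .
  interpret M: module R "self_module R" by (rule self_module)
  have inv: "\<ominus>\<^bsub>self_module R\<^esub> x = \<ominus> x" for x
    by (simp add: a_inv_def self_module_def m_inv_def)
  have "submodule I R (self_module R)"
    by (rule M.submoduleI) (auto simp: inv, auto simp: self_module_def I.I_l_closed)
  then show ?thesis
    by (rule submodule.submodule_is_module) (rule self_module)
qed

text \<open>The lifting property is applied to the inclusion of \<open>I\<close> into
  \<open>R\<close>; \<open>y\<close> is the value of the lift at 1.\<close>

lemma (in cring) injective_module_imp_baer_injective:
  assumes "injective_module R E" shows "baer_injective R E"
  unfolding baer_injective_def
proof (intro allI impI, elim conjE)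
  fix I f assume I: "ideal I R" and f: "f \<in> module_hom R (ideal_module R I) E"
  interpret I: ideal I R by fact
  interpret E: module R E using assms by (simp add: injective_module_def)
  have "(\<lambda>x. x) \<in> module_hom R (ideal_module R I) (self_module R)"
    unfolding module_hom_ideal_iff by (simp add: self_module_def subset_eq I.Icarr)
  then have "module R (ideal_module R I) \<and> module R (self_module R) \<and>
      (\<lambda>x. x) \<in> module_hom R (ideal_module R I) (self_module R) \<and>
      inj_on (\<lambda>x. x) (carrier (ideal_module R I)) \<and> f \<in> module_hom R (ideal_module R I) E"
    using f ideal_module[OF I] self_module by (intro conjI) auto
  then have "\<exists>g\<in>module_hom R (self_module R) E. \<forall>x\<in>carrier (ideal_module R I). g x = f x"
    by (rule assms[unfolded injective_module_def, THEN conjunct2, THEN spec, THEN spec, THEN spec, THEN spec, THEN mp])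
  then obtain g where g: "g \<in> module_hom R (self_module R) E" "\<forall>x\<in>I. g x = f x"
    by auto
  have "g \<in> carrier R \<rightarrow> carrier E" "\<forall>r\<in>carrier R. \<forall>x\<in>carrier R. g (r \<otimes> x) = r \<odot>\<^bsub>E\<^esub> g x"
    using g(1) by (simp_all add: module_hom_def self_module_def)
  then have "g \<one> \<in> carrier E" "\<And>r. r \<in> carrier R \<Longrightarrow> g (r \<otimes> \<one>) = r \<odot>\<^bsub>E\<^esub> g \<one>"
    using one_closed by blast+
  then show "\<exists>y\<in>carrier E. \<forall>r\<in>I. f r = r \<odot>\<^bsub>E\<^esub> y"
    using g(2) I.Icarr by (metis r_one)
qed

lemma (in cring) mem_add_cgenideal_iff:
  "z \<in> I <+>\<^bsub>R\<^esub> PIdl x \<longleftrightarrow> (\<exists>u\<in>I. \<exists>s\<in>carrier R. z = u \<oplus> s \<otimes> x)"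
  unfolding set_add_def' cgenideal_def by blast

text \<open>A map on \<open>K\<close> and the map \<open>s x \<mapsto> s y\<close> on the multiples
  of \<open>x\<close> glue to a map on the sum as soon as they agree on the overlap, which is what
  \<open>eq\<close> demands.\<close>

lemma (in module) extend_hom:
  assumes K: "ideal K R" and h: "h \<in> module_hom R (ideal_module R K) M"
    and x: "x \<in> carrier R" and y: "y \<in> carrier M"
    and eq: "\<And>s. s \<in> carrier R \<Longrightarrow> s \<otimes> x \<in> K \<Longrightarrow> h (s \<otimes> x) = s \<odot>\<^bsub>M\<^esub> y"
  obtains h' where "h' \<in> module_hom R (ideal_module R (K <+>\<^bsub>R\<^esub> PIdl x)) M"
    and "\<And>u s. u \<in> K \<Longrightarrow> s \<in> carrier R \<Longrightarrow> h' (u \<oplus> s \<otimes> x) = h u \<oplus>\<^bsub>M\<^esub> s \<odot>\<^bsub>M\<^esub> y"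
proof -
  interpret K: ideal K R by fact
  have h_carr: "h u \<in> carrier M" if "u \<in> K" for u
    using h that by (auto simp: module_hom_ideal_iff)
  have h_add: "h (u \<oplus> u') = h u \<oplus>\<^bsub>M\<^esub> h u'" if "u \<in> K" "u' \<in> K" for u u'
    using h that by (auto simp: module_hom_ideal_iff)
  have h_smult: "h (s \<otimes> u) = s \<odot>\<^bsub>M\<^esub> h u" if "u \<in> K" "s \<in> carrier R" for u s
    using h that by (auto simp: module_hom_ideal_iff)
  have wd: "h u \<oplus>\<^bsub>M\<^esub> s \<odot>\<^bsub>M\<^esub> y = h u' \<oplus>\<^bsub>M\<^esub> s' \<odot>\<^bsub>M\<^esub> y"
    if u: "u \<in> K" "u' \<in> K" and s: "s \<in> carrier R" "s' \<in> carrier R"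
      and e: "u \<oplus> s \<otimes> x = u' \<oplus> s' \<otimes> x" for u u' s s'
  proof -
    note uc [simp] = K.Icarr[OF u(1)] K.Icarr[OF u(2)]
    \<comment> \<open>Two expressions of one element differ by a multiple of \<open>x\<close> that
      lies in \<open>K\<close>, where \<open>eq\<close> compares \<open>h\<close> with
      multiplication into \<open>y\<close>.\<close>
    have "(s \<ominus> s') \<otimes> x = (u \<oplus> s \<otimes> x) \<ominus> u \<ominus> s' \<otimes> x"
      using s x uc by algebra
    also have "\<dots> = u' \<ominus> u" unfolding e using s x uc by algebra
    finally have d: "(s \<ominus> s') \<otimes> x = u' \<ominus> u" .
    have dK: "u' \<ominus> u \<in> K" using u unfolding a_minus_def by auto
    have "h u' = h ((u' \<ominus> u) \<oplus> u)"
      by (rule arg_cong[of _ _ h]) (use uc in algebra)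
    also have "\<dots> = (s \<ominus> s') \<odot>\<^bsub>M\<^esub> y \<oplus>\<^bsub>M\<^esub> h u"
      using eq[of "s \<ominus> s'"] dK u s d by (simp add: h_add)
    finally have "h u' \<oplus>\<^bsub>M\<^esub> s' \<odot>\<^bsub>M\<^esub> y = h u \<oplus>\<^bsub>M\<^esub> ((s \<ominus> s') \<odot>\<^bsub>M\<^esub> y \<oplus>\<^bsub>M\<^esub> s' \<odot>\<^bsub>M\<^esub> y)"
      using s y h_carr[OF u(1)] by (simp add: M.a_ac)
    also have "(s \<ominus> s') \<odot>\<^bsub>M\<^esub> y \<oplus>\<^bsub>M\<^esub> s' \<odot>\<^bsub>M\<^esub> y = ((s \<ominus> s') \<oplus> s') \<odot>\<^bsub>M\<^esub> y"
      using s y by (simp add: smult_l_distr)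
    also have "(s \<ominus> s') \<oplus> s' = s" using s by algebra
    finally show ?thesis by simp
  qed
  \<comment> \<open>The representation \<open>u \<oplus> s \<otimes> x\<close> is not unique, so a
    value is chosen; by \<open>wd\<close> the choice does not affect it.\<close>
  define h' where "h' z = (SOME w. \<exists>u\<in>K. \<exists>s\<in>carrier R. z = u \<oplus> s \<otimes> x \<and> w = h u \<oplus>\<^bsub>M\<^esub> s \<odot>\<^bsub>M\<^esub> y)" for z
  have val: "h' (u \<oplus> s \<otimes> x) = h u \<oplus>\<^bsub>M\<^esub> s \<odot>\<^bsub>M\<^esub> y" if "u \<in> K" "s \<in> carrier R" for u s
    unfolding h'_def
  proof (rule some_equality)
    show "\<exists>u'\<in>K. \<exists>s'\<in>carrier R. u \<oplus> s \<otimes> x = u' \<oplus> s' \<otimes> x \<and>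
        h u \<oplus>\<^bsub>M\<^esub> s \<odot>\<^bsub>M\<^esub> y = h u' \<oplus>\<^bsub>M\<^esub> s' \<odot>\<^bsub>M\<^esub> y"
      using that by (intro bexI[of _ u] bexI[of _ s]) simp_all
  next
    fix w assume "\<exists>u'\<in>K. \<exists>s'\<in>carrier R. u \<oplus> s \<otimes> x = u' \<oplus> s' \<otimes> x \<and> w = h u' \<oplus>\<^bsub>M\<^esub> s' \<odot>\<^bsub>M\<^esub> y"
    then obtain u' s' where *: "u' \<in> K" "s' \<in> carrier R" "u \<oplus> s \<otimes> x = u' \<oplus> s' \<otimes> x"
        "w = h u' \<oplus>\<^bsub>M\<^esub> s' \<odot>\<^bsub>M\<^esub> y" by blast
    show "w = h u \<oplus>\<^bsub>M\<^esub> s \<odot>\<^bsub>M\<^esub> y"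
      unfolding *(4) by (rule wd[OF *(1) that(1) *(2) that(2) *(3)[symmetric]])
  qed
  have "h' \<in> module_hom R (ideal_module R (K <+>\<^bsub>R\<^esub> PIdl x)) M"
    unfolding module_hom_ideal_iff
  proof (intro conjI ballI Pi_I)
    fix z assume "z \<in> K <+>\<^bsub>R\<^esub> PIdl x"
    then show "h' z \<in> carrier M"
      using y by (auto simp: mem_add_cgenideal_iff val h_carr)
  next
    fix z z' assume "z \<in> K <+>\<^bsub>R\<^esub> PIdl x" "z' \<in> K <+>\<^bsub>R\<^esub> PIdl x"
    then obtain u s u' s' where *: "u \<in> K" "s \<in> carrier R" "z = u \<oplus> s \<otimes> x"
        "u' \<in> K" "s' \<in> carrier R" "z' = u' \<oplus> s' \<otimes> x"
      by (auto simp: mem_add_cgenideal_iff)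
    note uc [simp] = K.Icarr[OF *(1)] K.Icarr[OF *(4)]
    have "z \<oplus> z' = (u \<oplus> u') \<oplus> (s \<oplus> s') \<otimes> x"
      unfolding *(3,6) using *(2,5) x uc by algebra
    then have "h' (z \<oplus> z') = (h u \<oplus>\<^bsub>M\<^esub> h u') \<oplus>\<^bsub>M\<^esub> (s \<odot>\<^bsub>M\<^esub> y \<oplus>\<^bsub>M\<^esub> s' \<odot>\<^bsub>M\<^esub> y)"
      using * y by (simp add: val h_add smult_l_distr)
    then show "h' (z \<oplus> z') = h' z \<oplus>\<^bsub>M\<^esub> h' z'"
      using * y by (simp add: val h_carr M.a_ac)
  next
    fix r z assume r: "r \<in> carrier R" and "z \<in> K <+>\<^bsub>R\<^esub> PIdl x"
    then obtain u s where *: "u \<in> K" "s \<in> carrier R" "z = u \<oplus> s \<otimes> x"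
      by (auto simp: mem_add_cgenideal_iff)
    note uc [simp] = K.Icarr[OF *(1)]
    have "r \<otimes> z = (r \<otimes> u) \<oplus> (r \<otimes> s) \<otimes> x"
      unfolding *(3) using *(2) x r uc by algebra
    then show "h' (r \<otimes> z) = r \<odot>\<^bsub>M\<^esub> h' z"
      using * y r by (simp add: val h_smult h_carr smult_r_distr smult_assoc1 K.I_l_closed)
  qed
  then show ?thesis using val that by blast
qed

text \<open>An element \<open>z\<close> killed by \<open>K\<close> is a homomorphism from R/K to
  \<open>M\<close>. By \<open>eq\<close>, sending the class of \<open>x\<close> to \<open>y\<close>
  is well defined on the submodule that this class generates, and injectivity extends it to
  R/K.\<close>

lemma (in module) baer_injective_separate:
  assumes "baer_injective R M" and K: "ideal K R" and x: "x \<in> carrier R" and y: "y \<in> carrier M"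
    and eq: "\<And>s. s \<in> carrier R \<Longrightarrow> s \<otimes> x \<in> K \<Longrightarrow> s \<odot>\<^bsub>M\<^esub> y = \<zero>\<^bsub>M\<^esub>"
  obtains z where "z \<in> carrier M" "\<And>u. u \<in> K \<Longrightarrow> u \<odot>\<^bsub>M\<^esub> z = \<zero>\<^bsub>M\<^esub>" "x \<odot>\<^bsub>M\<^esub> z = y"
proof -
  interpret K: ideal K R by fact
  have "(\<lambda>_. \<zero>\<^bsub>M\<^esub>) \<in> module_hom R (ideal_module R K) M"
    by (simp add: module_hom_ideal_iff)
  then obtain h where h: "h \<in> module_hom R (ideal_module R (K <+>\<^bsub>R\<^esub> PIdl x)) M"
      and val: "\<And>u s. u \<in> K \<Longrightarrow> s \<in> carrier R \<Longrightarrow> h (u \<oplus> s \<otimes> x) = \<zero>\<^bsub>M\<^esub> \<oplus>\<^bsub>M\<^esub> s \<odot>\<^bsub>M\<^esub> y"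
    by (rule extend_hom[OF K _ x y]) (use eq in auto)
  obtain z where z: "z \<in> carrier M" "\<And>r. r \<in> K <+>\<^bsub>R\<^esub> PIdl x \<Longrightarrow> h r = r \<odot>\<^bsub>M\<^esub> z"
    using assms(1)[unfolded baer_injective_def, THEN spec, THEN spec, THEN mp,
        OF conjI[OF add_ideals[OF K cgenideal_ideal[OF x]] h]] by blast
  show ?thesis
  proof
    show "z \<in> carrier M" by fact
    fix u assume u: "u \<in> K"
    have "u = u \<oplus> \<zero> \<otimes> x" using u x K.Icarr by simp
    then have "u \<in> K <+>\<^bsub>R\<^esub> PIdl x" "h u = \<zero>\<^bsub>M\<^esub>"
      using u val[of u \<zero>] y by (auto simp: mem_add_cgenideal_iff)
    then show "u \<odot>\<^bsub>M\<^esub> z = \<zero>\<^bsub>M\<^esub>" using z by simp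
  next
    have x_eq: "\<zero> \<oplus> \<one> \<otimes> x = x" using x by simp
    then have "x \<in> K <+>\<^bsub>R\<^esub> PIdl x"
      using mem_add_cgenideal_iff K.zero_closed R.one_closed by metis
    moreover have "h x = y"
      using val[OF K.zero_closed R.one_closed] y unfolding x_eq by simp
    ultimately show "x \<odot>\<^bsub>M\<^esub> z = y" using z by simp
  qed
qed

section \<open>Elementary properties of module homomorphisms and their kernels\<close>

lemma module_homD:
  assumes "f \<in> module_hom R M N"
  shows "x \<in> carrier M \<Longrightarrow> f x \<in> carrier N"
    and "x \<in> carrier M \<Longrightarrow> y \<in> carrier M \<Longrightarrow> f (x \<oplus>\<^bsub>M\<^esub> y) = f x \<oplus>\<^bsub>N\<^esub> f y"
    and "r \<in> carrier R \<Longrightarrow> x \<in> carrier M \<Longrightarrow> f (r \<odot>\<^bsub>M\<^esub> x) = r \<odot>\<^bsub>N\<^esub> f x"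
  using assms unfolding module_hom_def by blast+

lemma module_hom_ideal_D:
  assumes "f \<in> module_hom R (ideal_module R I) M"
  shows "x \<in> I \<Longrightarrow> f x \<in> carrier M"
    and "x \<in> I \<Longrightarrow> y \<in> I \<Longrightarrow> f (x \<oplus>\<^bsub>R\<^esub> y) = f x \<oplus>\<^bsub>M\<^esub> f y"
    and "r \<in> carrier R \<Longrightarrow> x \<in> I \<Longrightarrow> f (r \<otimes>\<^bsub>R\<^esub> x) = r \<odot>\<^bsub>M\<^esub> f x"
  using assms unfolding module_hom_ideal_iff by blast+

lemma baer_injectiveD:
  assumes "baer_injective R E" "ideal I R" "f \<in> module_hom R (ideal_module R I) E"
  obtains y where "y \<in> carrier E" "\<And>r. r \<in> I \<Longrightarrow> f r = r \<odot>\<^bsub>E\<^esub> y"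
  using assms(1)[unfolded baer_injective_def, THEN spec, THEN spec, THEN mp, OF conjI[OF assms(2,3)]]
  by blast

lemma module_hom_zero:
  assumes "module R M" "module R N" and f: "f \<in> module_hom R M N"
  shows "f \<zero>\<^bsub>M\<^esub> = \<zero>\<^bsub>N\<^esub>"
proof -
  interpret M: module R M by fact
  interpret N: module R N by fact
  show ?thesis
    using module_homD(1)[OF f M.zero_closed] module_homD(3)[OF f M.R.zero_closed M.zero_closed] by simp
qed

lemma module_hom_uminus:
  assumes "module R M" "module R N" and f: "f \<in> module_hom R M N" and x: "x \<in> carrier M"
  shows "f (\<ominus>\<^bsub>M\<^esub> x) = \<ominus>\<^bsub>N\<^esub> f x"
proof -
  interpret M: module R M by fact
  interpret N: module R N by fact
  have "f (\<ominus>\<^bsub>R\<^esub> \<one>\<^bsub>R\<^esub> \<odot>\<^bsub>M\<^esub> x) = \<ominus>\<^bsub>R\<^esub> \<one>\<^bsub>R\<^esub> \<odot>\<^bsub>N\<^esub> f x"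
    by (rule module_homD(3)[OF f _ x]) simp
  then show ?thesis
    using x module_homD(1)[OF f x] by (simp add: M.smult_l_minus N.smult_l_minus)
qed

lemma module_hom_minus:
  assumes "module R M" "module R N" and f: "f \<in> module_hom R M N"
    and x: "x \<in> carrier M" and y: "y \<in> carrier M"
  shows "f (x \<ominus>\<^bsub>M\<^esub> y) = f x \<ominus>\<^bsub>N\<^esub> f y"
proof -
  interpret M: module R M by fact
  show ?thesis
    using x y module_homD(2)[OF f x M.a_inv_closed[OF y]] module_hom_uminus[OF assms(1,2) f y]
    by (simp add: a_minus_def)
qed

lemma module_hom_kernel_submodule:
  assumes "module R M" "module R N" and f: "f \<in> module_hom R M N"
  shows "submodule {x \<in> carrier M. f x = \<zero>\<^bsub>N\<^esub>} R M"
proof -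
  interpret M: module R M by fact
  interpret N: module R N by fact
  show ?thesis
    by (rule M.submoduleI)
      (auto simp: module_hom_zero[OF assms] module_hom_uminus[OF assms] module_homD[OF f])
qed

lemma (in module) colon_submodule_ideal:
  assumes H: "submodule H R M" and y: "y \<in> carrier M"
  shows "ideal {s \<in> carrier R. s \<odot>\<^bsub>M\<^esub> y \<in> H} R"
proof (rule idealI)
  show "subgroup {s \<in> carrier R. s \<odot>\<^bsub>M\<^esub> y \<in> H} (add_monoid R)"
  proof (rule R.add.subgroupI)
    have "\<zero> \<odot>\<^bsub>M\<^esub> y \<in> H"
      using submoduleE(2,3,5)[OF H] M.r_neg submoduleE(1)[OF H] y by fastforce
    then show "{s \<in> carrier R. s \<odot>\<^bsub>M\<^esub> y \<in> H} \<noteq> {}" using R.zero_closed by blast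
  qed (use y submoduleE(3,5)[OF H] in \<open>auto simp: smult_l_distr smult_l_minus\<close>)
next
  fix a x assume a: "a \<in> {s \<in> carrier R. s \<odot>\<^bsub>M\<^esub> y \<in> H}" and x: "x \<in> carrier R"
  then show "x \<otimes> a \<in> {s \<in> carrier R. s \<odot>\<^bsub>M\<^esub> y \<in> H}"
    using y submoduleE(4)[OF H] by (simp add: smult_assoc1)
  then show "a \<otimes> x \<in> {s \<in> carrier R. s \<odot>\<^bsub>M\<^esub> y \<in> H}"
    using a x by (simp add: m_comm)
qed (rule R.ring_axioms)

section \<open>Artinian local rings\<close>

text \<open>Serves for noetherian induction, with \<open>P\<close> the failure of a property, and
  for choosing a maximal domain of a partial homomorphism.\<close>

lemma (in noetherian_ring) maximal_ideal_obtain: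
  assumes "P I" "ideal I R"
  obtains J where "P J" "ideal J R" "I \<subseteq> J" "\<And>K. P K \<Longrightarrow> ideal K R \<Longrightarrow> J \<subseteq> K \<Longrightarrow> K = J"
proof -
  let ?A = "{J. P J \<and> ideal J R \<and> I \<subseteq> J}"
  have "\<exists>M\<in>?A. \<forall>X\<in>?A. M \<subseteq> X \<longrightarrow> X = M"
  proof (rule subset_Zorn_nonempty)
    show "?A \<noteq> {}" using assms by auto
    fix C assume C: "C \<noteq> {}" "subset.chain ?A C"
    then have "subset.chain {I. ideal I R} C" by (auto simp: pred_on.chain_def)
    \<comment> \<open>A nonempty chain of ideals in a noetherian ring contains its union, so the
      upper bound inherits \<open>P\<close> although \<open>P\<close> is arbitrary.\<close>
    then have "\<Union> C \<in> C" using ideal_chain_is_trivial C by blast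
    then show "\<Union> C \<in> ?A" using C by (auto simp: pred_on.chain_def)
  qed
  then show ?thesis using that by (metis (no_types, lifting) mem_Collect_eq subset_trans)
qed

context local_ring
begin

lemma maximal_carrier: "\<mm> \<subseteq> carrier R" "\<one> \<notin> \<mm>"
  using I_notcarr one_imp_carrier a_subset by auto

lemma proper_ideal_subset_maximal:
  assumes I: "ideal I R" "I \<noteq> carrier R"
  shows "I \<subseteq> \<mm>"
proof -
  obtain J where J: "J \<noteq> carrier R" "ideal J R" "I \<subseteq> J"
      "\<And>K. K \<noteq> carrier R \<Longrightarrow> ideal K R \<Longrightarrow> J \<subseteq> K \<Longrightarrow> K = J"
    using maximal_ideal_obtain[of "\<lambda>J. J \<noteq> carrier R" I] I by blast
  then have "maximalideal J R" by (intro maximalidealI) auto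
  then show ?thesis using unique_maximalideal J by blast
qed

lemma Units_if_not_mem_maximal:
  assumes "x \<in> carrier R" "x \<notin> \<mm>" shows "x \<in> Units R"
proof -
  have "PIdl x = carrier R"
    using proper_ideal_subset_maximal[OF cgenideal_ideal[OF assms(1)]] cgenideal_self assms by blast
  then have "\<one> \<in> PIdl x" by simp
  then obtain y where "y \<in> carrier R" "\<one> = y \<otimes> x" by (auto simp: cgenideal_def)
  then show ?thesis using assms(1) m_comm unfolding Units_def by force
qed

text \<open>Elements outside \<open>\<mm>\<close> are units. For a socle element of R/K this shows
  that its annihilator is \<open>\<mm>\<close>, so that it spans a copy of the residue
  field.\<close>

lemma mem_maximal_if_annihilates:
  assumes "ideal K R" "s \<in> carrier R" "x \<in> carrier R" "s \<otimes> x \<in> K" "x \<notin> K"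
  shows "s \<in> \<mm>"
proof (rule ccontr)
  interpret K: ideal K R by fact
  assume "s \<notin> \<mm>"
  then have u: "s \<in> Units R" using assms Units_if_not_mem_maximal by blast
  then have "inv s \<otimes> (s \<otimes> x) \<in> K" using K.I_l_closed assms(4) u by simp
  also have "inv s \<otimes> (s \<otimes> x) = x" using u assms by (simp add: m_assoc[symmetric])
  finally show False using assms(5) by blast
qed

end

context artinian_local_ring
begin

lemma minimal_ideal_obtain:
  assumes "P I" and ideal: "\<And>I. P I \<Longrightarrow> ideal I R"
  obtains J where "P J" "\<And>K. P K \<Longrightarrow> K \<subseteq> J \<Longrightarrow> K = J"
proof (rule ccontr)
  note obtained = that
  assume no: "\<not> thesis"
  have step: "\<exists>K. P K \<and> K \<subset> J" if J: "P J" for J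
  proof (rule ccontr)
    assume "\<not> (\<exists>K. P K \<and> K \<subset> J)"
    then have "K = J" if "P K" "K \<subseteq> J" for K using that by (simp add: psubset_eq)
    then have thesis by (rule obtained[OF J])
    with no show False ..
  qed
  \<comment> \<open>Iterating a choice of strictly smaller members gives a descending chain that
    never becomes stationary.\<close>
  define g where "g J = (SOME K. P K \<and> K \<subset> J)" for J
  have g: "P (g J)" "g J \<subset> J" if "P J" for J
    using someI_ex[OF step[OF that]] unfolding g_def by (rule conjunct1, rule conjunct2)
  define c where "c n = (g ^^ n) I" for n
  have c_Suc: "c (Suc n) = g (c n)" for n by (simp add: c_def)
  have P: "P (c n)" for n
  proof (induction n)
    case 0 show ?case using assms(1) by (simp add: c_def)
  next
    case (Suc n) then show ?case unfolding c_Suc by (rule g(1))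
  qed
  have s: "c (Suc n) \<subset> c n" for n unfolding c_Suc by (rule g(2)[OF P])
  obtain N where N: "\<forall>n\<ge>N. c n = c N"
    using descending_chain_condition[of c, OF ideal[OF P] psubset_imp_subset[OF s]] by blast
  have "c (Suc N) = c N" by (rule N[rule_format]) simp
  with s show False by blast
qed

text \<open>A minimal ideal among the sums of \<open>I\<close> and \<open>PIdl x\<close> with
  \<open>x\<close> outside \<open>I\<close> is simple over \<open>I\<close>. If
  \<open>y \<otimes> x\<close> were outside \<open>I\<close> for some \<open>y\<close> in
  \<open>\<mm>\<close>, minimality would put \<open>x\<close> into the ideal generated by
  \<open>I\<close> and \<open>y \<otimes> x\<close>.\<close>

lemma socle_of_quotient:
  assumes I: "ideal I R" "I \<noteq> carrier R"
  obtains x where "x \<in> carrier R" "x \<notin> I" "\<And>y. y \<in> \<mm> \<Longrightarrow> y \<otimes> x \<in> I"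
proof -
  interpret I: ideal I R by fact
  let ?P = "\<lambda>J. \<exists>x\<in>carrier R. x \<notin> I \<and> J = I <+>\<^bsub>R\<^esub> PIdl x"
  have "\<one> \<notin> I" using I I.one_imp_carrier by blast
  then have "?P (I <+>\<^bsub>R\<^esub> PIdl \<one>)" by blast
  moreover have "\<And>J. ?P J \<Longrightarrow> ideal J R"
    using add_ideals[OF I(1) cgenideal_ideal] by blast
  ultimately obtain J where J: "?P J" and min: "\<And>K. ?P K \<Longrightarrow> K \<subseteq> J \<Longrightarrow> K = J"
    using minimal_ideal_obtain[of ?P] by blast
  from J obtain x where x: "x \<in> carrier R" "x \<notin> I" "J = I <+>\<^bsub>R\<^esub> PIdl x" by blast
  have "y \<otimes> x \<in> I" if y: "y \<in> \<mm>" for y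
  proof (rule ccontr)
    assume n: "y \<otimes> x \<notin> I"
    have yc: "y \<in> carrier R" using y maximal_carrier by blast
    let ?K = "I <+>\<^bsub>R\<^esub> PIdl (y \<otimes> x)"
    have "?K \<subseteq> J"
    proof
      fix z assume "z \<in> ?K"
      then obtain u s where "u \<in> I" "s \<in> carrier R" "z = u \<oplus> s \<otimes> (y \<otimes> x)"
        by (auto simp: mem_add_cgenideal_iff)
      then have "z = u \<oplus> (s \<otimes> y) \<otimes> x" "s \<otimes> y \<in> carrier R"
        using yc x by (auto simp: m_assoc)
      then show "z \<in> J" using \<open>u \<in> I\<close> unfolding x(3) mem_add_cgenideal_iff by blast
    qed
    then have "?K = J" using min n x yc by blast
    moreover have "x \<in> J"
      unfolding x(3) mem_add_cgenideal_iff
      using x by (intro bexI[of _ \<zero>] bexI[of _ \<one>]) auto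
    ultimately obtain u s where us: "u \<in> I" "s \<in> carrier R" "x = u \<oplus> s \<otimes> (y \<otimes> x)"
      by (auto simp: mem_add_cgenideal_iff)
    have uc: "u \<in> carrier R" using us I.Icarr by blast
    \<comment> \<open>Nakayama's argument: \<open>\<one> \<ominus> s \<otimes> y\<close> kills
      \<open>x\<close> modulo \<open>I\<close> and so lies in \<open>\<mm>\<close>, as does
      \<open>s \<otimes> y\<close>.\<close>
    have "(\<one> \<ominus> s \<otimes> y) \<otimes> x = x \<ominus> s \<otimes> (y \<otimes> x)" using us(2) yc x(1) by algebra
    also have "\<dots> = (u \<oplus> s \<otimes> (y \<otimes> x)) \<ominus> s \<otimes> (y \<otimes> x)"
      by (rule arg_cong[of _ _ "\<lambda>z. z \<ominus> s \<otimes> (y \<otimes> x)"]) (rule us(3))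
    also have "\<dots> = u" using us(2) yc x(1) uc by algebra
    finally have "(\<one> \<ominus> s \<otimes> y) \<in> \<mm>"
      using mem_maximal_if_annihilates[OF I(1) _ x(1)] us(1,2) yc x(2) by simp
    then have "(\<one> \<ominus> s \<otimes> y) \<oplus> s \<otimes> y \<in> \<mm>" using y us(2) I_l_closed a_closed by blast
    also have "(\<one> \<ominus> s \<otimes> y) \<oplus> s \<otimes> y = \<one>" using us(2) yc by algebra
    finally show False using maximal_carrier by blast
  qed
  then show ?thesis using that x by blast
qed

text \<open>A socle element modulo \<open>P\<close> lies outside \<open>P\<close>, but its product
  with every element of \<open>\<mm>\<close> is in \<open>P\<close>; primality puts
  \<open>\<mm>\<close> into \<open>P\<close>.\<close>

lemma primeideal_eq_maximal:
  assumes "primeideal P R" shows "P = \<mm>"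
proof -
  interpret P: primeideal P R by fact
  obtain x where x: "x \<in> carrier R" "x \<notin> P" "\<And>y. y \<in> \<mm> \<Longrightarrow> y \<otimes> x \<in> P"
    using socle_of_quotient[OF P.is_ideal P.I_notcarr[symmetric]] by blast
  have "\<mm> \<subseteq> P"
  proof
    fix y assume "y \<in> \<mm>"
    then show "y \<in> P" using P.I_prime[of y x] x maximal_carrier by auto
  qed
  moreover have "P \<subseteq> \<mm>" by (rule proper_ideal_subset_maximal[OF P.is_ideal P.I_notcarr[symmetric]])
  ultimately show ?thesis by blast
qed

text \<open>Serves to reduce a system of parameters to the empty list.\<close>

lemma krull_dim_eq_0: "krull_dim R = 0"
proof -
  let ?chain = "\<lambda>n P. (\<forall>i\<le>n::nat. primeideal (P i) R) \<and> (\<forall>i<n. P i \<subset> P (Suc i))"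
  have "n = 0" if "?chain n P" for n P
  proof (rule ccontr)
    assume "n \<noteq> 0"
    then have "primeideal (P 0) R" "primeideal (P (Suc 0)) R" "P 0 \<subset> P (Suc 0)"
      using that by auto
    then show False using primeideal_eq_maximal by blast
  qed
  then have "enat n \<le> 0" if "?chain n P" for n P
    using \<open>?chain n P \<Longrightarrow> n = 0\<close>[OF that] by (simp add: zero_enat_def)
  then have "krull_dim R \<le> 0" unfolding krull_dim_def by (intro Sup_least) blast
  then show ?thesis by simp
qed

end

section \<open>Self-injective Artinian local rings\<close>

context artinian_local_ring
begin

text \<open>The last two clauses make \<open>\<mm>\<close> the annihilator of \<open>t\<close>, so
  the multiples of \<open>t\<close> are a copy of the residue field inside the ring.\<close>

lemma socle_element:
  obtains t where "t \<in> carrier R" "t \<noteq> \<zero>" "\<And>y. y \<in> \<mm> \<Longrightarrow> y \<otimes> t = \<zero>"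
    "\<And>s. s \<in> carrier R \<Longrightarrow> s \<otimes> t = \<zero> \<Longrightarrow> s \<in> \<mm>"
proof -
  have "{\<zero>} \<noteq> carrier R" using maximal_carrier(2) zero_closed one_closed by (metis singletonD)
  then obtain t where t: "t \<in> carrier R" "t \<notin> {\<zero>}" "\<And>y. y \<in> \<mm> \<Longrightarrow> y \<otimes> t \<in> {\<zero>}"
    using socle_of_quotient[OF zeroideal] by blast
  show ?thesis
  proof
    show "s \<in> \<mm>" if "s \<in> carrier R" "s \<otimes> t = \<zero>" for s
      using mem_maximal_if_annihilates[OF zeroideal that(1) t(1) _ t(2)] that(2) by simp
  qed (use t in auto)
qed

text \<open>For \<open>E\<close> and \<open>C\<close> injective, \<open>Ext\<^sup>1(k, ker d) = 0\<close>: a homomorphism \<open>k \<rightarrow> C\<close> extends to \<open>R\<close> because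
  \<open>k\<close> embeds into \<open>R\<close>, hence lifts to \<open>E\<close>. The lift of an element of \<open>C\<close> killed by \<open>I\<close>, that is of a
  homomorphism \<open>R/I \<rightarrow> C\<close>, is reduced to this by noetherian induction on \<open>I\<close>.\<close>

lemma lift_annihilated:
  assumes E: "module R E" and C: "module R C" and d: "d \<in> module_hom R E C"
    and surj: "carrier C \<subseteq> d ` carrier E"
    and baer_E: "baer_injective R E" and baer_C: "baer_injective R C"
    and I: "ideal I R" and c: "c \<in> carrier C" and Ic: "\<And>r. r \<in> I \<Longrightarrow> r \<odot>\<^bsub>C\<^esub> c = \<zero>\<^bsub>C\<^esub>"
  shows "\<exists>e\<in>carrier E. d e = c \<and> (\<forall>r\<in>I. r \<odot>\<^bsub>E\<^esub> e = \<zero>\<^bsub>E\<^esub>)"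
proof -
  interpret E: module R E by fact
  interpret C: module R C by fact
  note d_closed = module_homD(1)[OF d] and d_add = module_homD(2)[OF d]
    and d_smult = module_homD(3)[OF d]
  \<comment> \<open>All \<open>c\<close> are covered at once, because the induction step passes from
    \<open>c\<close> to a corrected element.\<close>
  define L where "L I \<longleftrightarrow> (\<forall>c\<in>carrier C. (\<forall>r\<in>I. r \<odot>\<^bsub>C\<^esub> c = \<zero>\<^bsub>C\<^esub>) \<longrightarrow>
      (\<exists>e\<in>carrier E. d e = c \<and> (\<forall>r\<in>I. r \<odot>\<^bsub>E\<^esub> e = \<zero>\<^bsub>E\<^esub>)))" for I
  have "L I"
  proof (rule ccontr)
    assume "\<not> L I"
    then obtain J where J: "\<not> L J" "ideal J R" "\<And>K. \<not> L K \<Longrightarrow> ideal K R \<Longrightarrow> J \<subseteq> K \<Longrightarrow> K = J"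
      using maximal_ideal_obtain[of "\<lambda>J. \<not> L J" I] I by metis
    interpret J: ideal J R by (rule J(2))
    have "L (carrier R)"
      unfolding L_def
    proof (intro ballI impI)
      fix c assume c: "c \<in> carrier C" "\<forall>r\<in>carrier R. r \<odot>\<^bsub>C\<^esub> c = \<zero>\<^bsub>C\<^esub>"
      then have "c = \<zero>\<^bsub>C\<^esub>" using C.smult_one one_closed by metis
      then show "\<exists>e\<in>carrier E. d e = c \<and> (\<forall>r\<in>carrier R. r \<odot>\<^bsub>E\<^esub> e = \<zero>\<^bsub>E\<^esub>)"
        using module_hom_zero[OF E C d] by (intro bexI[of _ "\<zero>\<^bsub>E\<^esub>"]) auto
    qed
    then have "J \<noteq> carrier R" using J(1) by auto
    \<comment> \<open>The class of \<open>x\<close> spans a copy of k in R/J, just as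
      \<open>t\<close> does in R.\<close>
    then obtain x where x: "x \<in> carrier R" "x \<notin> J" "\<And>y. y \<in> \<mm> \<Longrightarrow> y \<otimes> x \<in> J"
      using socle_of_quotient[OF J(2)] by blast
    obtain t where t: "t \<in> carrier R" "t \<noteq> \<zero>" "\<And>y. y \<in> \<mm> \<Longrightarrow> y \<otimes> t = \<zero>"
        "\<And>s. s \<in> carrier R \<Longrightarrow> s \<otimes> t = \<zero> \<Longrightarrow> s \<in> \<mm>"
      by (rule socle_element) blast
    let ?K = "J <+>\<^bsub>R\<^esub> PIdl x"
    have K: "ideal ?K R" by (rule add_ideals[OF J(2) cgenideal_ideal[OF x(1)]])
    have JK: "J \<subseteq> ?K"
    proof
      fix u assume "u \<in> J"
      moreover have "u \<oplus> \<zero> \<otimes> x = u" using J.Icarr[OF \<open>u \<in> J\<close>] x(1) by simp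
      ultimately show "u \<in> ?K" using mem_add_cgenideal_iff J.Icarr[OF J.zero_closed] by metis
    qed
    have "\<zero> \<oplus> \<one> \<otimes> x = x" using x(1) by simp
    then have xK: "x \<in> ?K" using mem_add_cgenideal_iff J.zero_closed one_closed by metis
    have "L ?K" using J(3)[OF _ K JK] xK x(2) by blast
    have "L J"
      unfolding L_def
    proof (intro ballI impI)
      fix c assume c: "c \<in> carrier C" "\<forall>r\<in>J. r \<odot>\<^bsub>C\<^esub> c = \<zero>\<^bsub>C\<^esub>"
      have "s \<odot>\<^bsub>C\<^esub> (x \<odot>\<^bsub>C\<^esub> c) = \<zero>\<^bsub>C\<^esub>" if "s \<in> carrier R" "s \<otimes> t \<in> {\<zero>}" for s
      proof -
        have "s \<otimes> x \<in> J" using x(3) t(4) that by simp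
        then show ?thesis using c x(1) that(1) C.smult_assoc1[of s x c] by simp
      qed
      then obtain c' where c': "c' \<in> carrier C" "t \<odot>\<^bsub>C\<^esub> c' = x \<odot>\<^bsub>C\<^esub> c"
        by (rule C.baer_injective_separate[OF baer_C zeroideal t(1) C.smult_closed[OF x(1) c(1)]])
      obtain e' where e': "e' \<in> carrier E" "d e' = c'" using surj c'(1) by blast
      have eq: "s \<odot>\<^bsub>E\<^esub> (t \<odot>\<^bsub>E\<^esub> e') = \<zero>\<^bsub>E\<^esub>" if "s \<in> carrier R" "s \<otimes> x \<in> J" for s
      proof -
        have "s \<otimes> t = \<zero>" using mem_maximal_if_annihilates[OF J(2) that(1) x(1) that(2) x(2)] t(3) by simp
        then show ?thesis using E.smult_assoc1[OF that(1) t(1) e'(1)] e'(1) by simp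
      qed
      from E.baer_injective_separate[OF baer_E J(2) x(1) E.smult_closed[OF t(1) e'(1)] eq]
      obtain e2 where e2: "e2 \<in> carrier E" "\<And>u. u \<in> J \<Longrightarrow> u \<odot>\<^bsub>E\<^esub> e2 = \<zero>\<^bsub>E\<^esub>"
          "x \<odot>\<^bsub>E\<^esub> e2 = t \<odot>\<^bsub>E\<^esub> e'" by blast
      \<comment> \<open>The error that \<open>e2\<close> leaves is killed by \<open>J\<close> and by
        \<open>x\<close>, hence by the larger ideal \<open>?K\<close>, where lifts exist by the
        maximality of \<open>J\<close>.\<close>
      let ?c = "c \<ominus>\<^bsub>C\<^esub> d e2"
      have dist: "r \<odot>\<^bsub>C\<^esub> ?c = r \<odot>\<^bsub>C\<^esub> c \<ominus>\<^bsub>C\<^esub> d (r \<odot>\<^bsub>E\<^esub> e2)" if "r \<in> carrier R" for r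
        using that c(1) e2(1) d_closed by (simp add: a_minus_def C.smult_r_distr C.smult_r_minus d_smult)
      have c2: "?c \<in> carrier C" using c(1) d_closed[OF e2(1)] by simp
      have "r \<odot>\<^bsub>C\<^esub> ?c = \<zero>\<^bsub>C\<^esub>" if r: "r \<in> ?K" for r
      proof -
        obtain u s where us: "u \<in> J" "s \<in> carrier R" "r = u \<oplus> s \<otimes> x"
          using r mem_add_cgenideal_iff by blast
        have "u \<odot>\<^bsub>C\<^esub> ?c = \<zero>\<^bsub>C\<^esub>"
          using dist[OF J.Icarr[OF us(1)]] us(1) c e2(2) module_hom_zero[OF E C d]
          by (simp add: a_minus_def)
        moreover have "x \<odot>\<^bsub>C\<^esub> ?c = \<zero>\<^bsub>C\<^esub>"
          unfolding dist[OF x(1)] e2(3) using d_smult[OF t(1) e'(1)] e'(2) c'(2) x(1) c(1)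
          by (simp add: a_minus_def C.r_neg)
        ultimately show ?thesis
          unfolding us(3) using us(2) c2 x(1) J.Icarr[OF us(1)]
          by (simp add: C.smult_l_distr C.smult_assoc1)
      qed
      then obtain e3 where e3: "e3 \<in> carrier E" "d e3 = ?c" "\<forall>r\<in>?K. r \<odot>\<^bsub>E\<^esub> e3 = \<zero>\<^bsub>E\<^esub>"
        using \<open>L ?K\<close> c2 unfolding L_def by blast
      have "d (e3 \<oplus>\<^bsub>E\<^esub> e2) = ?c \<oplus>\<^bsub>C\<^esub> d e2" using d_add e3 e2(1) by simp
      also have "\<dots> = c" using c(1) d_closed[OF e2(1)] by (simp add: a_minus_def C.a_assoc C.l_neg)
      finally have "d (e3 \<oplus>\<^bsub>E\<^esub> e2) = c" .
      moreover have "r \<odot>\<^bsub>E\<^esub> (e3 \<oplus>\<^bsub>E\<^esub> e2) = \<zero>\<^bsub>E\<^esub>" if "r \<in> J" for r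
        using that JK e3(1,3) e2(1,2) J.Icarr[OF that] by (simp add: E.smult_r_distr subset_iff)
      ultimately show "\<exists>e\<in>carrier E. d e = c \<and> (\<forall>r\<in>J. r \<odot>\<^bsub>E\<^esub> e = \<zero>\<^bsub>E\<^esub>)"
        using e3(1) e2(1) by (intro bexI[of _ "e3 \<oplus>\<^bsub>E\<^esub> e2"]) simp_all
    qed
    with J(1) show False ..
  qed
  then show ?thesis using c Ic unfolding L_def by blast
qed

text \<open>A homomorphism from \<open>I\<close> to the kernel is multiplication into some
  \<open>e\<close> of \<open>E\<close>, and \<open>I\<close> kills \<open>d e\<close>. Subtracting a
  lift of \<open>d e\<close> that \<open>I\<close> also kills moves \<open>e\<close> into the kernel
  without changing the products.\<close>

lemma baer_injective_kernel:
  assumes E: "module R E" and C: "module R C" and d: "d \<in> module_hom R E C"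
    and surj: "carrier C \<subseteq> d ` carrier E"
    and baer_E: "baer_injective R E" and baer_C: "baer_injective R C"
  shows "baer_injective R (E\<lparr>carrier := {x \<in> carrier E. d x = \<zero>\<^bsub>C\<^esub>}\<rparr>)"
  unfolding baer_injective_def
proof (intro allI impI, elim conjE)
  interpret E: module R E by fact
  interpret C: module R C by fact
  fix I f
  assume I: "ideal I R"
    and f: "f \<in> module_hom R (ideal_module R I) (E\<lparr>carrier := {x \<in> carrier E. d x = \<zero>\<^bsub>C\<^esub>}\<rparr>)"
  interpret I: ideal I R by (rule I)
  have fd: "f r \<in> carrier E" "d (f r) = \<zero>\<^bsub>C\<^esub>" if "r \<in> I" for r
    using module_hom_ideal_D(1)[OF f that] by simp_all
  have "f \<in> module_hom R (ideal_module R I) E"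
    using f fd unfolding module_hom_ideal_iff by simp
  then obtain e where e: "e \<in> carrier E" "\<And>r. r \<in> I \<Longrightarrow> f r = r \<odot>\<^bsub>E\<^esub> e"
    by (rule baer_injectiveD[OF baer_E I]) blast
  have "r \<odot>\<^bsub>C\<^esub> d e = \<zero>\<^bsub>C\<^esub>" if "r \<in> I" for r
    using module_homD(3)[OF d I.Icarr[OF that] e(1)] e(2)[OF that] fd(2)[OF that] by simp
  then obtain e' where e': "e' \<in> carrier E" "d e' = d e" "\<forall>r\<in>I. r \<odot>\<^bsub>E\<^esub> e' = \<zero>\<^bsub>E\<^esub>"
    using lift_annihilated[OF E C d surj baer_E baer_C I module_homD(1)[OF d e(1)]] by blast
  have "d (e \<ominus>\<^bsub>E\<^esub> e') = \<zero>\<^bsub>C\<^esub>"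
    using module_hom_minus[OF E C d e(1) e'(1)] e'(2) module_homD(1)[OF d e(1)]
    by (simp add: a_minus_def C.r_neg)
  moreover have "f r = r \<odot>\<^bsub>E\<^esub> (e \<ominus>\<^bsub>E\<^esub> e')" if "r \<in> I" for r
    using e e' that I.Icarr[OF that] by (simp add: a_minus_def E.smult_r_distr E.smult_r_minus)
  ultimately show "\<exists>y\<in>carrier (E\<lparr>carrier := {x \<in> carrier E. d x = \<zero>\<^bsub>C\<^esub>}\<rparr>).
      \<forall>r\<in>I. f r = r \<odot>\<^bsub>E\<lparr>carrier := {x \<in> carrier E. d x = \<zero>\<^bsub>C\<^esub>}\<rparr>\<^esub> y"
    using e(1) e'(1) by (intro bexI[of _ "e \<ominus>\<^bsub>E\<^esub> e'"]) simp_all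
qed

text \<open>By exactness \<open>d i\<close> maps \<open>E i\<close> onto the cosyzygy
  \<open>Z (Suc i)\<close> with kernel \<open>Z i\<close>, so injectivity travels down from the zero
  end of the resolution to \<open>Z 0\<close>, which is isomorphic to \<open>M\<close>.\<close>

lemma finite_injective_dimension_imp_baer_injective:
  fixes M :: "('a, 'c) module"
  assumes M: "module R M" and "finite_injective_dimension R M"
  shows "baer_injective R M"
proof -
  obtain n :: nat and E :: "nat \<Rightarrow> ('a, 'c) module" and \<epsilon> d where
      inj: "\<forall>i. injective_module R (E i)"
    and zero: "\<forall>i>n. carrier (E i) = {\<zero>\<^bsub>E i\<^esub>}"
    and \<epsilon>: "\<epsilon> \<in> module_hom R M (E 0)" "inj_on \<epsilon> (carrier M)"
    and d': "\<forall>i. d i \<in> module_hom R (E i) (E (Suc i))"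
    and ex0: "\<epsilon> ` carrier M = {x \<in> carrier (E 0). d 0 x = \<zero>\<^bsub>E 1\<^esub>}"
    and ex: "\<forall>i. d i ` carrier (E i) = {x \<in> carrier (E (Suc i)). d (Suc i) x = \<zero>\<^bsub>E (Suc (Suc i))\<^esub>}"
    using assms(2) unfolding finite_injective_dimension_def by (elim exE conjE) (rule that)
  note d = d'[rule_format]
  have mod: "module R (E i)" for i using inj by (simp add: injective_module_def)
  define Z where "Z i = (E i)\<lparr>carrier := {x \<in> carrier (E i). d i x = \<zero>\<^bsub>E (Suc i)\<^esub>}\<rparr>" for i
  have Z_mod: "module R (Z i)" for i
    unfolding Z_def
    by (rule submodule.submodule_is_module[OF module_hom_kernel_submodule[OF mod mod d] mod])
  have d_Z: "d i \<in> module_hom R (E i) (Z (Suc i))" for i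
    using d[of i] ex[rule_format, of i] unfolding module_hom_def Z_def by auto
  have "baer_injective R (Z 0)"
  \<comment> \<open>The descent starts at \<open>Suc n\<close>, the first index at which the
    resolution is certain to vanish.\<close>
  proof (rule inc_induct[of 0 "Suc n"])
    show "baer_injective R (Z (Suc n))"
      unfolding baer_injective_def
    proof (intro allI impI, elim conjE)
      interpret Z: module R "Z (Suc n)" by (rule Z_mod)
      have Z0: "x = \<zero>\<^bsub>Z (Suc n)\<^esub>" if "x \<in> carrier (Z (Suc n))" for x
        using that zero[rule_format, of "Suc n"] by (simp add: Z_def)
      fix I f assume I: "ideal I R" and f: "f \<in> module_hom R (ideal_module R I) (Z (Suc n))"
      interpret I: ideal I R by (rule I)
      have "f r = r \<odot>\<^bsub>Z (Suc n)\<^esub> \<zero>\<^bsub>Z (Suc n)\<^esub>" if "r \<in> I" for r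
        using Z0[OF module_hom_ideal_D(1)[OF f that]] I.Icarr[OF that] by simp
      then show "\<exists>y\<in>carrier (Z (Suc n)). \<forall>r\<in>I. f r = r \<odot>\<^bsub>Z (Suc n)\<^esub> y"
        using Z.zero_closed by blast
    qed
  next
    fix i assume "baer_injective R (Z (Suc i))"
    moreover have "carrier (Z (Suc i)) \<subseteq> d i ` carrier (E i)" by (simp add: Z_def ex)
    ultimately have "baer_injective R ((E i)\<lparr>carrier := {x \<in> carrier (E i). d i x = \<zero>\<^bsub>Z (Suc i)\<^esub>}\<rparr>)"
      by (intro baer_injective_kernel[OF mod Z_mod d_Z] injective_module_imp_baer_injective[OF inj[rule_format]])
    then show "baer_injective R (Z i)" by (simp add: Z_def)
  qed simp
  show ?thesis
    unfolding baer_injective_def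
  proof (intro allI impI, elim conjE)
    interpret M: module R M by (rule M)
    fix I f assume I: "ideal I R" and f: "f \<in> module_hom R (ideal_module R I) M"
    interpret I: ideal I R by (rule I)
    \<comment> \<open>The problem is carried into \<open>Z 0\<close> along
      \<open>\<epsilon>\<close>; injectivity of \<open>\<epsilon>\<close> carries the solution
      back.\<close>
    have "(\<lambda>r. \<epsilon> (f r)) \<in> module_hom R (ideal_module R I) (Z 0)"
      unfolding module_hom_ideal_iff Z_def
      using module_hom_ideal_D[OF f] module_homD[OF \<epsilon>(1)] ex0 by auto
    then obtain y where y: "y \<in> carrier (Z 0)" "\<And>r. r \<in> I \<Longrightarrow> \<epsilon> (f r) = r \<odot>\<^bsub>Z 0\<^esub> y"
      by (rule baer_injectiveD[OF \<open>baer_injective R (Z 0)\<close> I]) blast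
    obtain m where m: "m \<in> carrier M" "y = \<epsilon> m"
      using y(1) ex0 unfolding Z_def by auto
    have "f r = r \<odot>\<^bsub>M\<^esub> m" if r: "r \<in> I" for r
    proof (rule inj_onD[OF \<epsilon>(2)])
      show "\<epsilon> (f r) = \<epsilon> (r \<odot>\<^bsub>M\<^esub> m)"
        using y(2)[OF r] module_homD(3)[OF \<epsilon>(1) I.Icarr[OF r] m(1)] m(2) by (simp add: Z_def)
    qed (use m(1) I.Icarr[OF r] module_hom_ideal_D(1)[OF f r] in auto)
    then show "\<exists>y\<in>carrier M. \<forall>r\<in>I. f r = r \<odot>\<^bsub>M\<^esub> y" using m(1) by blast
  qed
qed

text \<open>If \<open>x\<close> were outside \<open>J\<close>, sending the class of \<open>x\<close>
  to the socle element \<open>t\<close> would be well defined. An extension to R/J is multiplication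
  by some \<open>z\<close> in 0 : J with \<open>x \<otimes> z = t\<close> nonzero, which contradicts
  \<open>ann\<close>.\<close>

lemma double_annihilator:
  assumes self: "baer_injective R (self_module R)" and J: "ideal J R" and x: "x \<in> carrier R"
    and ann: "\<And>s. s \<in> carrier R \<Longrightarrow> (\<And>j. j \<in> J \<Longrightarrow> s \<otimes> j = \<zero>) \<Longrightarrow> s \<otimes> x = \<zero>"
  shows "x \<in> J"
proof (rule ccontr)
  assume xJ: "x \<notin> J"
  interpret S: module R "self_module R" by (rule self_module)
  interpret J: ideal J R by (rule J)
  obtain t where t: "t \<in> carrier R" "t \<noteq> \<zero>" "\<And>y. y \<in> \<mm> \<Longrightarrow> y \<otimes> t = \<zero>"
    by (rule socle_element) blast
  have eq: "s \<odot>\<^bsub>self_module R\<^esub> t = \<zero>\<^bsub>self_module R\<^esub>" if "s \<in> carrier R" "s \<otimes> x \<in> J" for s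
    using t(3)[OF mem_maximal_if_annihilates[OF J that(1) x that(2) xJ]] by (simp add: self_module_def)
  have "t \<in> carrier (self_module R)" using t(1) by (simp add: self_module_def)
  from S.baer_injective_separate[OF self J x this eq]
  obtain z where z: "z \<in> carrier (self_module R)" "\<And>u. u \<in> J \<Longrightarrow> u \<odot>\<^bsub>self_module R\<^esub> z = \<zero>\<^bsub>self_module R\<^esub>"
      "x \<odot>\<^bsub>self_module R\<^esub> z = t" by blast
  then have z': "z \<in> carrier R" "\<And>u. u \<in> J \<Longrightarrow> u \<otimes> z = \<zero>" "x \<otimes> z = t"
    by (simp_all add: self_module_def)
  have "z \<otimes> x = \<zero>"
    by (rule ann[OF z'(1)]) (use z'(1,2) J.Icarr m_comm in metis)
  then show False using z'(1,3) x t(2) by (simp add: m_comm)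
qed

text \<open>The hypotheses describe the injective hull \<open>W\<close> of \<open>k\<close> over \<open>R / soc R\<close>, regarded as an
  \<open>R\<close>-module: \<open>R v\<close> is an essential copy of \<open>k\<close>, and \<open>ext\<close> is Baer's criterion over \<open>R / soc R\<close>, which
  applies because \<open>soc R\<close> kills \<open>x\<close>. A maximal extension of \<open>soc R \<cong> R v\<close> yields \<open>h\<close>. Its image is all
  of \<open>W\<close>, because \<open>\<mm>\<close>, being the annihilator of \<open>soc R\<close> in the self-injective ring \<open>R\<close>, is injective
  over \<open>R / soc R\<close> and so has no proper essential extension.\<close>

lemma maximal_ideal_bij_essential:
  assumes self: "baer_injective R (self_module R)" and W: "module R W"
    and soc: "\<And>s y. s \<in> socle R \<mm> \<Longrightarrow> y \<in> carrier W \<Longrightarrow> s \<odot>\<^bsub>W\<^esub> y = \<zero>\<^bsub>W\<^esub>"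
    and v: "v \<in> carrier W" "v \<noteq> \<zero>\<^bsub>W\<^esub>" "\<And>r. r \<in> \<mm> \<Longrightarrow> r \<odot>\<^bsub>W\<^esub> v = \<zero>\<^bsub>W\<^esub>"
    and ess: "\<And>y. y \<in> carrier W \<Longrightarrow> y \<noteq> \<zero>\<^bsub>W\<^esub> \<Longrightarrow>
      \<exists>s\<in>carrier R. s \<odot>\<^bsub>W\<^esub> y \<noteq> \<zero>\<^bsub>W\<^esub> \<and> (\<exists>r\<in>carrier R. s \<odot>\<^bsub>W\<^esub> y = r \<odot>\<^bsub>W\<^esub> v)"
    and ext: "\<And>K h x. ideal K R \<Longrightarrow> K \<subseteq> \<mm> \<Longrightarrow> h \<in> module_hom R (ideal_module R K) W \<Longrightarrow> x \<in> \<mm> \<Longrightarrow>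
      \<exists>y\<in>carrier W. \<forall>s\<in>carrier R. s \<otimes> x \<in> K \<longrightarrow> h (s \<otimes> x) = s \<odot>\<^bsub>W\<^esub> y"
  obtains h where "h \<in> module_hom R (ideal_module R \<mm>) W" "bij_betw h \<mm> (carrier W)"
proof -
  interpret W: module R W by (rule W)
  obtain t where t: "t \<in> carrier R" "t \<noteq> \<zero>" "\<And>y. y \<in> \<mm> \<Longrightarrow> y \<otimes> t = \<zero>"
      "\<And>s. s \<in> carrier R \<Longrightarrow> s \<otimes> t = \<zero> \<Longrightarrow> s \<in> \<mm>"
    by (rule socle_element) blast
  have t_soc: "t \<in> socle R \<mm>"
    using t(1,3) maximal_carrier(1) by (auto simp: socle_def colon_ideal_def m_comm)
  \<comment> \<open>Otherwise the ring would be a field, and its socle, containing a unit, would not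
    kill \<open>v\<close>.\<close>
  have t\<mm>: "t \<in> \<mm>"
  proof (rule ccontr)
    assume "t \<notin> \<mm>"
    then have "t \<in> Units R" using Units_if_not_mem_maximal t(1) by blast
    then have "v = inv t \<odot>\<^bsub>W\<^esub> (t \<odot>\<^bsub>W\<^esub> v)"
      using v(1) t(1) by (simp flip: W.smult_assoc1)
    also have "\<dots> = \<zero>\<^bsub>W\<^esub>" using soc[OF t_soc v(1)] \<open>t \<in> Units R\<close> by simp
    finally show False using v(2) by blast
  qed
  \<comment> \<open>Partial maps are required to send \<open>t\<close> to \<open>v\<close>.
    Maximality is asked of the domain alone, since \<open>ext\<close> enlarges every domain smaller
    than \<open>\<mm>\<close>.\<close>
  define P where "P K \<longleftrightarrow> K \<subseteq> \<mm> \<and> t \<in> K \<and> (\<exists>h\<in>module_hom R (ideal_module R K) W. h t = v)" for K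
  have zero_hom: "(\<lambda>_. \<zero>\<^bsub>W\<^esub>) \<in> module_hom R (ideal_module R {\<zero>}) W"
    by (simp add: module_hom_ideal_iff)
  have "\<zero>\<^bsub>W\<^esub> = s \<odot>\<^bsub>W\<^esub> v" if "s \<in> carrier R" "s \<otimes> t \<in> {\<zero>}" for s
    using v(3)[OF t(4)] that by simp
  from W.extend_hom[OF zeroideal zero_hom t(1) v(1) this]
  obtain h0 where h0: "h0 \<in> module_hom R (ideal_module R ({\<zero>} <+>\<^bsub>R\<^esub> PIdl t)) W"
      "\<And>u s. u \<in> {\<zero>} \<Longrightarrow> s \<in> carrier R \<Longrightarrow> h0 (u \<oplus> s \<otimes> t) = \<zero>\<^bsub>W\<^esub> \<oplus>\<^bsub>W\<^esub> s \<odot>\<^bsub>W\<^esub> v" by blast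
  have t_eq: "\<zero> \<oplus> \<one> \<otimes> t = t" using t(1) by simp
  have "P ({\<zero>} <+>\<^bsub>R\<^esub> PIdl t)"
    unfolding P_def
  proof (intro conjI bexI[OF _ h0(1)])
    show "{\<zero>} <+>\<^bsub>R\<^esub> PIdl t \<subseteq> \<mm>"
      using t(1) t\<mm> I_l_closed by (auto simp: mem_add_cgenideal_iff)
    show "t \<in> {\<zero>} <+>\<^bsub>R\<^esub> PIdl t"
      using mem_add_cgenideal_iff t_eq one_closed by (metis singletonI)
    show "h0 t = v" using h0(2)[of \<zero> \<one>] t_eq v(1) by simp
  qed
  then obtain K where K: "P K" "ideal K R" "\<And>K'. P K' \<Longrightarrow> ideal K' R \<Longrightarrow> K \<subseteq> K' \<Longrightarrow> K' = K"
    using maximal_ideal_obtain[of P, OF _ add_ideals[OF zeroideal cgenideal_ideal[OF t(1)]]] by metis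
  interpret K: ideal K R by (rule K(2))
  from K(1) obtain h where K\<mm>: "K \<subseteq> \<mm>" and tK: "t \<in> K"
    and h: "h \<in> module_hom R (ideal_module R K) W" "h t = v" unfolding P_def by blast
  have "K = \<mm>"
  proof (rule ccontr)
    assume "K \<noteq> \<mm>"
    then obtain x where x: "x \<in> \<mm>" "x \<notin> K" using K\<mm> by blast
    have xc: "x \<in> carrier R" using x(1) maximal_carrier(1) by blast
    obtain y where y: "y \<in> carrier W" "\<And>s. s \<in> carrier R \<Longrightarrow> s \<otimes> x \<in> K \<Longrightarrow> h (s \<otimes> x) = s \<odot>\<^bsub>W\<^esub> y"
      using ext[OF K(2) K\<mm> h(1) x(1)] by blast
    from W.extend_hom[OF K(2) h(1) xc y(1) y(2)]
    obtain h' where h': "h' \<in> module_hom R (ideal_module R (K <+>\<^bsub>R\<^esub> PIdl x)) W"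
        "\<And>u s. u \<in> K \<Longrightarrow> s \<in> carrier R \<Longrightarrow> h' (u \<oplus> s \<otimes> x) = h u \<oplus>\<^bsub>W\<^esub> s \<odot>\<^bsub>W\<^esub> y" by blast
    have zc: "\<zero> \<in> carrier R" by (rule K.Icarr[OF K.zero_closed])
    have u_eq: "u \<oplus> \<zero> \<otimes> x = u" if "u \<in> K" for u using K.Icarr[OF that] xc by simp
    have sub: "K \<subseteq> K <+>\<^bsub>R\<^esub> PIdl x"
      using mem_add_cgenideal_iff u_eq zc by (metis subsetI)
    have "P (K <+>\<^bsub>R\<^esub> PIdl x)"
      unfolding P_def
    proof (intro conjI bexI[OF _ h'(1)])
      show "K <+>\<^bsub>R\<^esub> PIdl x \<subseteq> \<mm>"
      proof
        fix z assume "z \<in> K <+>\<^bsub>R\<^esub> PIdl x"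
        then obtain u s where us: "u \<in> K" "s \<in> carrier R" "z = u \<oplus> s \<otimes> x"
          using mem_add_cgenideal_iff by blast
        show "z \<in> \<mm>"
          unfolding us(3) by (rule a_closed[OF subsetD[OF K\<mm> us(1)] I_l_closed[OF x(1) us(2)]])
      qed
      show "t \<in> K <+>\<^bsub>R\<^esub> PIdl x" using sub tK by blast
      show "h' t = v" using h'(2)[OF tK zc] u_eq[OF tK] h(2) v(1) y(1) by simp
    qed
    then have "K <+>\<^bsub>R\<^esub> PIdl x = K"
      using K(3) add_ideals[OF K(2) cgenideal_ideal[OF xc]] sub by blast
    moreover have "\<zero> \<oplus> \<one> \<otimes> x = x" using xc by simp
    then have "x \<in> K <+>\<^bsub>R\<^esub> PIdl x" using mem_add_cgenideal_iff K.zero_closed one_closed by metis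
    ultimately show False using x(2) by blast
  qed
  with h have h: "h \<in> module_hom R (ideal_module R \<mm>) W" "h t = v" by simp_all
  note hD = module_hom_ideal_D[OF h(1)]
  have h_minus: "h (a \<ominus> b) = h a \<ominus>\<^bsub>W\<^esub> h b" if "a \<in> \<mm>" "b \<in> \<mm>" for a b
  proof -
    have bc: "b \<in> carrier R" using that maximal_carrier(1) by blast
    have "\<ominus> \<one> \<otimes> b = \<ominus> b" using bc by (simp add: l_minus)
    then have "h (\<ominus> b) = \<ominus>\<^bsub>W\<^esub> h b"
      using hD(3)[of "\<ominus> \<one>" b] that hD(1) by (simp add: W.smult_l_minus)
    then show ?thesis using hD(2)[of a "\<ominus> b"] that by (simp add: a_minus_def)
  qed
  have h_zero: "h \<zero> = \<zero>\<^bsub>W\<^esub>"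
    using h_minus[of t t] t\<mm> hD(1)[OF t\<mm>] t(1) by (simp add: a_minus_def r_neg W.r_neg)
  have ker: "a = \<zero>" if a: "a \<in> \<mm>" "h a = \<zero>\<^bsub>W\<^esub>" for a
  proof (rule ccontr)
    assume "a \<noteq> \<zero>"
    have ac: "a \<in> carrier R" using a maximal_carrier(1) by blast
    \<comment> \<open>Every nonzero ideal contains \<open>t\<close>: whatever kills a nonzero
      \<open>a\<close> lies in \<open>\<mm>\<close> and kills \<open>t\<close>. Hence an element of
      the kernel of \<open>h\<close> other than 0 would force \<open>v\<close> to vanish.\<close>
    have "t \<in> PIdl a"
    proof (rule double_annihilator[OF self cgenideal_ideal[OF ac] t(1)])
      fix s assume s: "s \<in> carrier R" and "\<And>j. j \<in> PIdl a \<Longrightarrow> s \<otimes> j = \<zero>"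
      then have "s \<otimes> a = \<zero>" using cgenideal_self[OF ac] by blast
      then have "s \<in> \<mm>" using mem_maximal_if_annihilates[OF zeroideal s ac] \<open>a \<noteq> \<zero>\<close> by simp
      then show "s \<otimes> t = \<zero>" by (rule t(3))
    qed
    then obtain s where "s \<in> carrier R" "t = s \<otimes> a" by (auto simp: cgenideal_def)
    then show False using hD(3)[of s a] a h(2) v(2) by simp
  qed
  have inj: "inj_on h \<mm>"
  proof (rule inj_onI)
    fix a b assume ab: "a \<in> \<mm>" "b \<in> \<mm>" "h a = h b"
    have c: "a \<in> carrier R" "b \<in> carrier R" using ab maximal_carrier(1) by auto
    have "a \<ominus> b \<in> \<mm>" using ab by (simp add: a_minus_def)
    moreover have "h (a \<ominus> b) = \<zero>\<^bsub>W\<^esub>"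
      using h_minus[OF ab(1,2)] ab(3) hD(1)[OF ab(2)] by (simp add: a_minus_def W.r_neg)
    ultimately have "a \<ominus> b = \<zero>" by (rule ker)
    then show "a = b" using c by simp
  qed
  define g where "g = the_inv_into \<mm> h"
  have g: "g (h a) = a" if "a \<in> \<mm>" for a
    unfolding g_def by (rule the_inv_into_f_f[OF inj that])
  have H: "submodule (h ` \<mm>) R W"
  proof (rule W.submoduleI)
    show "\<zero>\<^bsub>W\<^esub> \<in> h ` \<mm>" using h_zero zero_closed by (metis imageI)
    show "\<ominus>\<^bsub>W\<^esub> a \<in> h ` \<mm>" if "a \<in> h ` \<mm>" for a
    proof -
      from that obtain b where b: "b \<in> \<mm>" "a = h b" by blast
      have "h (\<zero> \<ominus> b) = \<ominus>\<^bsub>W\<^esub> a"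
        using h_minus[OF zero_closed b(1)] h_zero b hD(1)[OF b(1)] by (simp add: a_minus_def)
      moreover have "\<zero> \<ominus> b \<in> \<mm>" using b(1) zero_closed by (simp add: a_minus_def)
      ultimately show ?thesis by (metis imageI)
    qed
  qed (use hD I_l_closed in \<open>auto simp flip: hD(2,3)\<close>)
  have "y \<in> h ` \<mm>" if y: "y \<in> carrier W" for y
  proof -
    \<comment> \<open>On \<open>?A\<close> the multiples of \<open>y\<close> can be pulled back
      through \<open>h\<close> to the ring; by self-injectivity the resulting map is multiplication
      by some \<open>t'\<close>, and \<open>h t'\<close> is the candidate for
      \<open>y\<close>.\<close>
    let ?A = "{s \<in> carrier R. s \<odot>\<^bsub>W\<^esub> y \<in> h ` \<mm>}"
    have A: "ideal ?A R" by (rule W.colon_submodule_ideal[OF H y])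
    have gA: "g (s \<odot>\<^bsub>W\<^esub> y) \<in> \<mm>" "h (g (s \<odot>\<^bsub>W\<^esub> y)) = s \<odot>\<^bsub>W\<^esub> y" if "s \<in> ?A" for s
      using that g by auto
    have "(\<lambda>s. g (s \<odot>\<^bsub>W\<^esub> y)) \<in> module_hom R (ideal_module R ?A) (self_module R)"
      unfolding module_hom_ideal_iff
    proof (intro conjI ballI Pi_I)
      fix s s' assume s: "s \<in> ?A" "s' \<in> ?A"
      have "(s \<oplus> s') \<odot>\<^bsub>W\<^esub> y = h (g (s \<odot>\<^bsub>W\<^esub> y) \<oplus> g (s' \<odot>\<^bsub>W\<^esub> y))"
        using s y gA[OF s(1)] gA[OF s(2)] by (simp add: hD(2) W.smult_l_distr)
      then show "g ((s \<oplus> s') \<odot>\<^bsub>W\<^esub> y) = g (s \<odot>\<^bsub>W\<^esub> y) \<oplus>\<^bsub>self_module R\<^esub> g (s' \<odot>\<^bsub>W\<^esub> y)"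
        using gA(1)[OF s(1)] gA(1)[OF s(2)] g by (simp add: self_module_def)
    next
      fix r s assume r: "r \<in> carrier R" and s: "s \<in> ?A"
      have "(r \<otimes> s) \<odot>\<^bsub>W\<^esub> y = h (r \<otimes> g (s \<odot>\<^bsub>W\<^esub> y))"
        using r s y gA[OF s] by (simp add: hD(3) W.smult_assoc1)
      then show "g ((r \<otimes> s) \<odot>\<^bsub>W\<^esub> y) = r \<odot>\<^bsub>self_module R\<^esub> g (s \<odot>\<^bsub>W\<^esub> y)"
        using gA(1)[OF s] r g I_l_closed by (simp add: self_module_def)
    next
      fix s assume "s \<in> ?A"
      then show "g (s \<odot>\<^bsub>W\<^esub> y) \<in> carrier (self_module R)"
        using gA(1) maximal_carrier(1) by (auto simp: self_module_def)
    qed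
    then obtain t' where t': "t' \<in> carrier (self_module R)"
        "\<And>s. s \<in> ?A \<Longrightarrow> g (s \<odot>\<^bsub>W\<^esub> y) = s \<odot>\<^bsub>self_module R\<^esub> t'"
      by (rule baer_injectiveD[OF self A]) blast
    have t'c: "t' \<in> carrier R" using t'(1) by (simp add: self_module_def)
    have t'A: "g (s \<odot>\<^bsub>W\<^esub> y) = s \<otimes> t'" if "s \<in> ?A" for s
      using t'(2)[OF that] by (simp add: self_module_def)
    \<comment> \<open>Since the socle kills \<open>y\<close>, the map on \<open>?A\<close> vanishes
      at \<open>t\<close>. So \<open>t'\<close> kills \<open>t\<close>, which places it in
      \<open>\<mm>\<close>, the domain of \<open>h\<close>.\<close>
    have "t \<odot>\<^bsub>W\<^esub> y = h \<zero>" using soc[OF t_soc y] h_zero by simp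
    then have "t \<in> ?A" "g (t \<odot>\<^bsub>W\<^esub> y) = \<zero>" using t(1) g zero_closed by auto
    then have "t' \<otimes> t = \<zero>" using t'A t(1) t'c by (simp add: m_comm)
    then have t'\<mm>: "t' \<in> \<mm>" using t(4) t'c by blast
    have A_eq: "s \<odot>\<^bsub>W\<^esub> y = s \<odot>\<^bsub>W\<^esub> h t'" if "s \<in> ?A" for s
      using gA(2)[OF that] t'A[OF that] hD(3)[OF _ t'\<mm>] that by simp
    have ht': "h t' \<in> carrier W" by (rule hD(1)[OF t'\<mm>])
    have dist: "s \<odot>\<^bsub>W\<^esub> (y \<ominus>\<^bsub>W\<^esub> h t') = s \<odot>\<^bsub>W\<^esub> y \<ominus>\<^bsub>W\<^esub> s \<odot>\<^bsub>W\<^esub> h t'" if "s \<in> carrier R" for s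
      using that y ht' by (simp add: a_minus_def W.smult_r_distr W.smult_r_minus)
    have "y \<ominus>\<^bsub>W\<^esub> h t' = \<zero>\<^bsub>W\<^esub>"
    proof (rule ccontr)
      assume "y \<ominus>\<^bsub>W\<^esub> h t' \<noteq> \<zero>\<^bsub>W\<^esub>"
      then obtain s r where s: "s \<in> carrier R" "s \<odot>\<^bsub>W\<^esub> (y \<ominus>\<^bsub>W\<^esub> h t') \<noteq> \<zero>\<^bsub>W\<^esub>"
          and r: "r \<in> carrier R" "s \<odot>\<^bsub>W\<^esub> (y \<ominus>\<^bsub>W\<^esub> h t') = r \<odot>\<^bsub>W\<^esub> v"
        using ess[of "y \<ominus>\<^bsub>W\<^esub> h t'"] y ht' by auto
      have rt: "r \<otimes> t \<in> \<mm>" and st: "s \<otimes> t' \<in> \<mm>" using r(1) s(1) t\<mm> t'\<mm> I_l_closed by auto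
      have "h (r \<otimes> t \<oplus> s \<otimes> t') = (s \<odot>\<^bsub>W\<^esub> y \<ominus>\<^bsub>W\<^esub> s \<odot>\<^bsub>W\<^esub> h t') \<oplus>\<^bsub>W\<^esub> s \<odot>\<^bsub>W\<^esub> h t'"
        using hD(2)[OF rt st] hD(3)[OF r(1) t\<mm>] hD(3)[OF s(1) t'\<mm>] h(2) r(2) dist[OF s(1)] by simp
      also have "\<dots> = s \<odot>\<^bsub>W\<^esub> y"
        using s(1) y ht' by (simp add: a_minus_def W.a_assoc W.l_neg)
      finally have "s \<in> ?A" using s(1) a_closed[OF rt st] by (metis (mono_tags, lifting) imageI mem_Collect_eq)
      then have "s \<odot>\<^bsub>W\<^esub> (y \<ominus>\<^bsub>W\<^esub> h t') = s \<odot>\<^bsub>W\<^esub> h t' \<ominus>\<^bsub>W\<^esub> s \<odot>\<^bsub>W\<^esub> h t'"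
        unfolding dist[OF s(1)] by (rule arg_cong[OF A_eq])
      also have "\<dots> = \<zero>\<^bsub>W\<^esub>"
        using W.smult_closed[OF s(1) ht'] by (simp add: a_minus_def W.r_neg)
      finally show False using s(2) by blast
    qed
    moreover have "(y \<ominus>\<^bsub>W\<^esub> h t') \<oplus>\<^bsub>W\<^esub> h t' = y"
      using y ht' by (simp add: a_minus_def W.a_assoc W.l_neg)
    ultimately have "y = h t'" using W.l_zero[OF ht'] by simp
    then show ?thesis using t'\<mm> by blast
  qed
  then have "bij_betw h \<mm> (carrier W)" using inj hD(1) by (auto simp: bij_betw_def)
  then show ?thesis using that h(1) by blast
qed

lemma socle_ideal: "ideal (socle R \<mm>) R"
proof -
  have "socle R \<mm> = {r \<in> carrier R. \<forall>x\<in>\<mm>. r \<otimes> x = \<zero>}"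
    by (simp add: socle_def colon_ideal_def)
  moreover have "ideal {r \<in> carrier R. \<forall>x\<in>\<mm>. r \<otimes> x = \<zero>} R"
  proof (rule idealI[OF ring_axioms])
    show "subgroup {r \<in> carrier R. \<forall>x\<in>\<mm>. r \<otimes> x = \<zero>} (add_monoid R)"
      using Icarr by (intro add.subgroupI) (auto simp: l_distr l_minus intro!: exI[of _ \<zero>])
  next
    fix a x assume a: "a \<in> {r \<in> carrier R. \<forall>x\<in>\<mm>. r \<otimes> x = \<zero>}" and x: "x \<in> carrier R"
    then show "x \<otimes> a \<in> {r \<in> carrier R. \<forall>x\<in>\<mm>. r \<otimes> x = \<zero>}"
      using Icarr by (simp add: m_assoc)
    then show "a \<otimes> x \<in> {r \<in> carrier R. \<forall>x\<in>\<mm>. r \<otimes> x = \<zero>}"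
      using a x by (simp add: m_comm)
  qed
  ultimately show ?thesis by simp
qed

end

section \<open>Quotients by the socle\<close>

text \<open>Composing with the coset map trades cosets for elements of \<open>S\<close>.\<close>

lemma quotient_iso_obtain:
  assumes S: "ring S" and R: "ring R" and J: "ideal J S" and iso: "S Quot J \<simeq> R"
  obtains \<pi> where "\<pi> \<in> ring_hom S R" "\<pi> ` carrier S = carrier R"
    "\<And>x. x \<in> carrier S \<Longrightarrow> \<pi> x = \<zero>\<^bsub>R\<^esub> \<longleftrightarrow> x \<in> J"
proof -
  interpret S: ring S by (rule S)
  interpret R: ring R by (rule R)
  interpret J: ideal J S by (rule J)
  interpret Q: ring "S Quot J" by (rule J.quotient_is_ring)
  obtain \<phi> where \<phi>: "\<phi> \<in> ring_hom (S Quot J) R" "bij_betw \<phi> (carrier (S Quot J)) (carrier R)"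
    using iso by (auto simp: is_ring_iso_def ring_iso_def)
  have Q: "carrier (S Quot J) = (+>\<^bsub>S\<^esub>) J ` carrier S"
    by (auto simp: FactRing_def A_RCOSETS_def')
  show ?thesis
  proof
    show "(\<lambda>x. \<phi> (J +>\<^bsub>S\<^esub> x)) \<in> ring_hom S R"
      using ring_hom_trans[OF J.rcos_ring_hom \<phi>(1)] by (simp add: comp_def)
    show "(\<lambda>x. \<phi> (J +>\<^bsub>S\<^esub> x)) ` carrier S = carrier R"
      using \<phi>(2) unfolding bij_betw_def Q by (simp add: image_image)
    fix x assume x: "x \<in> carrier S"
    have "\<phi> J = \<zero>\<^bsub>R\<^esub>"
      using ring_hom_zero[OF \<phi>(1) Q.ring_axioms R] by (simp add: FactRing_def)
    moreover have "J \<in> carrier (S Quot J)" using Q.zero_closed by (simp add: FactRing_def)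
    moreover have "J +>\<^bsub>S\<^esub> x \<in> carrier (S Quot J)" using x by (simp add: Q)
    ultimately have "\<phi> (J +>\<^bsub>S\<^esub> x) = \<zero>\<^bsub>R\<^esub> \<longleftrightarrow> J +>\<^bsub>S\<^esub> x = J"
      using \<phi>(2) by (auto simp: bij_betw_def inj_on_def)
    also have "\<dots> \<longleftrightarrow> x \<in> J"
      using J.rcos_const_imp_mem[OF x] S.a_rcos_zero[OF J] by blast
    finally show "\<phi> (J +>\<^bsub>S\<^esub> x) = \<zero>\<^bsub>R\<^esub> \<longleftrightarrow> x \<in> J" .
  qed
qed

section \<open>Restriction of scalars along a ring homomorphism\<close>

definition restrict_scalars ::
    "('b \<Rightarrow> 'a) \<Rightarrow> ('a, 'c, 'w) module_scheme \<Rightarrow> ('b, 'c) module"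
  where "restrict_scalars \<pi> M =
    \<lparr>carrier = carrier M, monoid.mult = (\<otimes>\<^bsub>M\<^esub>), one = \<one>\<^bsub>M\<^esub>, ring.zero = \<zero>\<^bsub>M\<^esub>, ring.add = (\<oplus>\<^bsub>M\<^esub>),
     smult = (\<lambda>s x. \<pi> s \<odot>\<^bsub>M\<^esub> x)\<rparr>"

lemma restrict_scalars_simps [simp]:
  "carrier (restrict_scalars \<pi> M) = carrier M"
  "\<zero>\<^bsub>restrict_scalars \<pi> M\<^esub> = \<zero>\<^bsub>M\<^esub>"
  "x \<oplus>\<^bsub>restrict_scalars \<pi> M\<^esub> y = x \<oplus>\<^bsub>M\<^esub> y"
  "s \<odot>\<^bsub>restrict_scalars \<pi> M\<^esub> x = \<pi> s \<odot>\<^bsub>M\<^esub> x"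
  by (simp_all add: restrict_scalars_def)

lemma restrict_scalars_module:
  assumes "cring S" and M: "module R M" and \<pi>: "\<pi> \<in> ring_hom S R"
  shows "module S (restrict_scalars \<pi> M)"
proof -
  interpret S: cring S by fact
  interpret M: module R M by (rule M)
  note hom = ring_hom_closed[OF \<pi>] ring_hom_add[OF \<pi>] ring_hom_mult[OF \<pi>] ring_hom_one[OF \<pi>]
  show ?thesis
  proof (rule moduleI)
    show "abelian_group (restrict_scalars \<pi> M)"
      by (rule abelian_groupI) (auto simp: M.a_ac intro: M.l_neg)
  qed (simp_all add: hom S.cring_axioms M.smult_l_distr M.smult_r_distr M.smult_assoc1)
qed

text \<open>The two rings have different element types, so \<open>R\<close> is tied to
  \<open>S\<close> by a surjection with kernel the socle. The Gorenstein hypothesis survives as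
  Baer's criterion for \<open>S\<close>.\<close>

locale socle_quotient = S: artinian_local_ring \<nn> S + R: artinian_local_ring \<mm> R
  for \<nn> and S (structure) and \<mm> and R +
  fixes \<pi>
  assumes hom: "\<pi> \<in> ring_hom S R" and surj: "\<pi> ` carrier S = carrier R"
    and ker: "x \<in> carrier S \<Longrightarrow> \<pi> x = \<zero>\<^bsub>R\<^esub> \<longleftrightarrow> x \<in> socle S \<nn>"
    and self_injective: "baer_injective S (self_module S)"
begin

sublocale \<pi>: ring_hom_cring S R \<pi>
  by (intro ring_hom_cring.intro S.cring_axioms R.cring_axioms ring_hom_cring_axioms.intro hom)

lemma socle_mult: "s \<in> socle S \<nn> \<Longrightarrow> x \<in> \<nn> \<Longrightarrow> s \<otimes> x = \<zero>"
  by (simp add: socle_def colon_ideal_def)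

lemma lift:
  assumes "r \<in> carrier R" obtains s where "s \<in> carrier S" "r = \<pi> s"
  using assms surj by blast

text \<open>The socle of a field is the whole field; this case is excluded because \<open>R\<close>,
  being local, is not the zero ring.\<close>

lemma socle_subset_maximal: "socle S \<nn> \<subseteq> \<nn>"
proof (rule S.proper_ideal_subset_maximal[OF S.socle_ideal])
  have "\<one>\<^bsub>R\<^esub> \<noteq> \<zero>\<^bsub>R\<^esub>" using R.maximal_carrier(2) R.zero_closed by metis
  then have "\<one> \<notin> socle S \<nn>" using ker[OF S.one_closed] by simp
  then show "socle S \<nn> \<noteq> carrier S" using S.one_closed by blast
qed

lemma hom_mem_maximal_iff:
  assumes s: "s \<in> carrier S" shows "\<pi> s \<in> \<mm> \<longleftrightarrow> s \<in> \<nn>"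
proof
  let ?V = "{s \<in> carrier S. \<pi> s \<in> \<mm>}"
  have "ideal ?V S" by (rule \<pi>.ring.ideal_vimage[OF R.is_ideal])
  moreover have "?V \<noteq> carrier S" using R.maximal_carrier(2) S.one_closed \<pi>.hom_one
    by (metis (mono_tags, lifting) mem_Collect_eq)
  ultimately have "?V \<subseteq> \<nn>" by (rule S.proper_ideal_subset_maximal)
  then show "\<pi> s \<in> \<mm> \<Longrightarrow> s \<in> \<nn>" using s by blast
next
  assume s\<nn>: "s \<in> \<nn>"
  show "\<pi> s \<in> \<mm>"
  proof (rule ccontr)
    assume "\<pi> s \<notin> \<mm>"
    then have "\<pi> s \<in> Units R" using R.Units_if_not_mem_maximal s by simp
    then obtain r where r: "r \<in> carrier R" "r \<otimes>\<^bsub>R\<^esub> \<pi> s = \<one>\<^bsub>R\<^esub>"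
      using R.Units_l_inv_ex by blast
    then obtain s' where s': "s' \<in> carrier S" "r = \<pi> s'" using lift by blast
    \<comment> \<open>An inverse of \<open>\<pi> s\<close> lifts to \<open>s'\<close> with
      \<open>\<one> \<ominus> s' \<otimes> s\<close> in the socle, hence in \<open>\<nn>\<close>; as
      \<open>s\<close> is in \<open>\<nn>\<close> too, so is 1.\<close>
    have "\<pi> (\<one> \<ominus> s' \<otimes> s) = \<zero>\<^bsub>R\<^esub>"
      using r s s' by (simp add: a_minus_def R.r_neg)
    then have "\<one> \<ominus> s' \<otimes> s \<in> \<nn>"
      using ker[of "\<one> \<ominus> s' \<otimes> s"] s s'(1) socle_subset_maximal by auto
    moreover have "s' \<otimes> s \<in> \<nn>" using s' s\<nn> S.I_l_closed by blast
    ultimately have "(\<one> \<ominus> s' \<otimes> s) \<oplus> s' \<otimes> s \<in> \<nn>" by (rule S.a_closed)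
    also have "(\<one> \<ominus> s' \<otimes> s) \<oplus> s' \<otimes> s = \<one>"
      using s s'(1) by (simp add: a_minus_def S.a_assoc S.l_neg)
    finally show False using S.maximal_carrier(2) by blast
  qed
qed

lemma annihilator_annihilator_subset:
  assumes I: "ideal I R"
  shows "colon_ideal R {\<zero>\<^bsub>R\<^esub>} (colon_ideal R {\<zero>\<^bsub>R\<^esub>} I) \<subseteq> colon_ideal R I \<mm>"
proof
  fix r assume r: "r \<in> colon_ideal R {\<zero>\<^bsub>R\<^esub>} (colon_ideal R {\<zero>\<^bsub>R\<^esub>} I)"
  then have rc: "r \<in> carrier R" by (simp add: colon_ideal_def)
  then obtain x where x: "x \<in> carrier S" "r = \<pi> x" by (rule lift)
  let ?J = "{s \<in> carrier S. \<pi> s \<in> I}"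
  have J: "ideal ?J S" by (rule \<pi>.ring.ideal_vimage[OF I])
  have "r \<otimes>\<^bsub>R\<^esub> z \<in> I" if z: "z \<in> \<mm>" for z
  proof -
    have "z \<in> carrier R" using z R.maximal_carrier(1) by blast
    then obtain w where w: "w \<in> carrier S" "z = \<pi> w" by (rule lift)
    have w\<nn>: "w \<in> \<nn>" using hom_mem_maximal_iff[OF w(1)] w(2) z by simp
    have "x \<otimes> w \<in> ?J"
    proof (rule S.double_annihilator[OF self_injective J])
      fix s assume s: "s \<in> carrier S" "\<And>j. j \<in> ?J \<Longrightarrow> s \<otimes> j = \<zero>"
      \<comment> \<open>Surjectivity of \<open>\<pi>\<close> turns s J = 0 into
        \<open>\<pi> s\<close> being in 0 : I, which \<open>r\<close> annihilates.\<close>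
      have "\<pi> s \<otimes>\<^bsub>R\<^esub> i = \<zero>\<^bsub>R\<^esub>" if i: "i \<in> I" for i
      proof -
        have "i \<in> carrier R" using i ideal.Icarr[OF I] by blast
        then obtain j where j: "j \<in> carrier S" "i = \<pi> j" by (rule lift)
        then have "\<pi> (s \<otimes> j) = \<zero>\<^bsub>R\<^esub>" using s(2)[of j] i by simp
        then show ?thesis using s(1) j by simp
      qed
      then have "r \<otimes>\<^bsub>R\<^esub> \<pi> s = \<zero>\<^bsub>R\<^esub>" using r s(1) by (simp add: colon_ideal_def)
      then have "\<pi> (x \<otimes> s) = \<zero>\<^bsub>R\<^esub>" using x s(1) by simp
      then have "x \<otimes> s \<in> socle S \<nn>" using ker[of "x \<otimes> s"] x(1) s(1) by simp
      then have "(x \<otimes> s) \<otimes> w = \<zero>" using socle_mult w\<nn> by blast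
      then show "s \<otimes> (x \<otimes> w) = \<zero>" using s(1) x(1) w(1) by (simp add: S.m_ac)
    qed (use x w in simp)
    then show ?thesis using x w by simp
  qed
  then show "r \<in> colon_ideal R I \<mm>" using rc by (simp add: colon_ideal_def)
qed

text \<open>The bijection from \<open>\<nn>\<close> to \<open>\<omega>\<close> is linear over
  \<open>S\<close>. Its inverse followed by \<open>\<pi>\<close> is linear over \<open>R\<close>,
  because scalars of \<open>R\<close> lift to \<open>S\<close>, and has image
  \<open>\<mm>\<close>.\<close>

lemma maximal_ideal_subset_trace:
  assumes hull: "is_injective_hull R (quotient_module R \<mm>) \<omega>"
  shows "\<mm> \<subseteq> trace_ideal R \<omega>"
proof -
  have \<omega>: "module R \<omega>" and baer: "baer_injective R \<omega>"
    using hull R.injective_module_imp_baer_injective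
    by (auto simp: is_injective_hull_def injective_module_def)
  interpret \<omega>: module R \<omega> by (rule \<omega>)
  obtain i where i: "i \<in> module_hom R (quotient_module R \<mm>) \<omega>" "inj_on i (carrier (quotient_module R \<mm>))"
      and ess: "\<And>N. submodule N R \<omega> \<Longrightarrow> N \<inter> i ` carrier (quotient_module R \<mm>) = {\<zero>\<^bsub>\<omega>\<^esub>} \<Longrightarrow> N = {\<zero>\<^bsub>\<omega>\<^esub>}"
    using hull unfolding is_injective_hull_def by blast
  have carr_Q: "carrier (quotient_module R \<mm>) = (+>\<^bsub>R\<^esub>) \<mm> ` carrier R"
    by (auto simp: quotient_module_def FactRing_def A_RCOSETS_def')
  \<comment> \<open>The image of 1 in k; the copy of k in \<open>\<omega>\<close> consists of the
    multiples of \<open>v\<close>.\<close>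
  define v where "v = i (\<mm> +>\<^bsub>R\<^esub> \<one>\<^bsub>R\<^esub>)"
  have i_coset: "i (\<mm> +>\<^bsub>R\<^esub> r) = r \<odot>\<^bsub>\<omega>\<^esub> v" if r: "r \<in> carrier R" for r
  proof -
    have "r \<odot>\<^bsub>quotient_module R \<mm>\<^esub> (\<mm> +>\<^bsub>R\<^esub> \<one>\<^bsub>R\<^esub>) = \<mm> +>\<^bsub>R\<^esub> r"
      using r R.rcoset_mult_add[OF r R.one_closed] by (simp add: quotient_module_def FactRing_def)
    moreover have "\<mm> +>\<^bsub>R\<^esub> \<one>\<^bsub>R\<^esub> \<in> carrier (quotient_module R \<mm>)" by (simp add: carr_Q)
    ultimately show ?thesis using module_homD(3)[OF i(1) r] unfolding v_def by metis
  qed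
  have v: "v \<in> carrier \<omega>" unfolding v_def by (rule module_homD(1)[OF i(1)]) (simp add: carr_Q)
  have \<mm>_coset: "\<mm> +>\<^bsub>R\<^esub> r = \<mm>" if "r \<in> \<mm>" for r by (rule R.a_rcos_zero[OF R.is_ideal that])
  have i\<mm>: "i \<mm> = \<zero>\<^bsub>\<omega>\<^esub>"
    using i_coset[OF R.Icarr[OF R.zero_closed]] \<mm>_coset[OF R.zero_closed] v by simp
  have \<mm>_v: "r \<odot>\<^bsub>\<omega>\<^esub> v = \<zero>\<^bsub>\<omega>\<^esub>" if "r \<in> \<mm>" for r
    using i_coset[OF R.Icarr[OF that]] \<mm>_coset[OF that] i\<mm> by simp
  have v0: "v \<noteq> \<zero>\<^bsub>\<omega>\<^esub>"
  proof
    assume "v = \<zero>\<^bsub>\<omega>\<^esub>"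
    then have "i (\<mm> +>\<^bsub>R\<^esub> \<one>\<^bsub>R\<^esub>) = i (\<mm> +>\<^bsub>R\<^esub> \<zero>\<^bsub>R\<^esub>)"
      using i\<mm> \<mm>_coset[OF R.zero_closed] by (simp add: v_def)
    then have "\<mm> +>\<^bsub>R\<^esub> \<one>\<^bsub>R\<^esub> = \<mm> +>\<^bsub>R\<^esub> \<zero>\<^bsub>R\<^esub>"
      by (rule inj_onD[OF i(2)]) (use R.Icarr[OF R.zero_closed] in \<open>auto simp: carr_Q\<close>)
    then have "\<one>\<^bsub>R\<^esub> \<in> \<mm>"
      using \<mm>_coset[OF R.zero_closed] R.rcos_const_imp_mem[OF R.one_closed] by simp
    then show False using R.maximal_carrier(2) by blast
  qed
  \<comment> \<open>The hull property, applied to the cyclic submodule generated by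
    \<open>y\<close>, gives a nonzero common multiple of \<open>y\<close> and \<open>v\<close>; the
    scalars are lifted to \<open>S\<close>.\<close>
  have essential: "\<exists>s\<in>carrier S. \<pi> s \<odot>\<^bsub>\<omega>\<^esub> y \<noteq> \<zero>\<^bsub>\<omega>\<^esub> \<and> (\<exists>r\<in>carrier S. \<pi> s \<odot>\<^bsub>\<omega>\<^esub> y = \<pi> r \<odot>\<^bsub>\<omega>\<^esub> v)"
    if y: "y \<in> carrier \<omega>" "y \<noteq> \<zero>\<^bsub>\<omega>\<^esub>" for y
  proof -
    let ?N = "(\<lambda>r. r \<odot>\<^bsub>\<omega>\<^esub> y) ` carrier R"
    have zc: "\<zero>\<^bsub>R\<^esub> \<in> carrier R" by (rule R.Icarr[OF R.zero_closed])
    have zN: "\<zero>\<^bsub>\<omega>\<^esub> \<in> ?N" using imageI[OF zc, of "\<lambda>r. r \<odot>\<^bsub>\<omega>\<^esub> y"] y(1) by simp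
    have N: "submodule ?N R \<omega>"
    proof (rule \<omega>.submoduleI)
      fix a assume "a \<in> ?N"
      then obtain r where "r \<in> carrier R" "a = r \<odot>\<^bsub>\<omega>\<^esub> y" by blast
      then show "\<ominus>\<^bsub>\<omega>\<^esub> a \<in> ?N"
        using y(1) by (intro image_eqI[of _ _ "\<ominus>\<^bsub>R\<^esub> r"]) (simp_all add: \<omega>.smult_l_minus)
    next
      fix a b assume "a \<in> ?N" "b \<in> ?N"
      then obtain r r' where "r \<in> carrier R" "a = r \<odot>\<^bsub>\<omega>\<^esub> y" "r' \<in> carrier R" "b = r' \<odot>\<^bsub>\<omega>\<^esub> y" by blast
      then show "a \<oplus>\<^bsub>\<omega>\<^esub> b \<in> ?N"
        using y(1) by (intro image_eqI[of _ _ "r \<oplus>\<^bsub>R\<^esub> r'"]) (simp_all add: \<omega>.smult_l_distr)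
    next
      fix c a assume c: "c \<in> carrier R" and "a \<in> ?N"
      then obtain r where "r \<in> carrier R" "a = r \<odot>\<^bsub>\<omega>\<^esub> y" by blast
      then show "c \<odot>\<^bsub>\<omega>\<^esub> a \<in> ?N"
        using y(1) c by (intro image_eqI[of _ _ "c \<otimes>\<^bsub>R\<^esub> r"]) (simp_all add: \<omega>.smult_assoc1)
    qed (use zN y(1) in auto)
    have "y \<in> ?N" using y(1) by (intro image_eqI[of _ _ "\<one>\<^bsub>R\<^esub>"]) simp_all
    then have "?N \<noteq> {\<zero>\<^bsub>\<omega>\<^esub>}" using y(2) by blast
    then have "?N \<inter> i ` carrier (quotient_module R \<mm>) \<noteq> {\<zero>\<^bsub>\<omega>\<^esub>}" using ess[OF N] by blast
    moreover have "\<zero>\<^bsub>\<omega>\<^esub> \<in> i ` carrier (quotient_module R \<mm>)"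
      using i\<mm> \<mm>_coset[OF R.zero_closed] zc unfolding carr_Q by (metis imageI)
    ultimately obtain a where a: "a \<in> ?N" "a \<in> i ` carrier (quotient_module R \<mm>)" "a \<noteq> \<zero>\<^bsub>\<omega>\<^esub>"
      using zN by blast
    then obtain r r' where r: "r \<in> carrier R" "a = r \<odot>\<^bsub>\<omega>\<^esub> y" "r' \<in> carrier R" "a = r' \<odot>\<^bsub>\<omega>\<^esub> v"
      using i_coset unfolding carr_Q by auto
    obtain s s' where "s \<in> carrier S" "r = \<pi> s" "s' \<in> carrier S" "r' = \<pi> s'"
      using lift[OF r(1)] lift[OF r(3)] by metis
    then show ?thesis using r a(3) by metis
  qed
  let ?W = "restrict_scalars \<pi> \<omega>"
  have W: "module S ?W" by (rule restrict_scalars_module[OF S.cring_axioms \<omega> hom])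
  \<comment> \<open>Baer's criterion is available over \<open>R\<close>, but \<open>K\<close> is an
    ideal of \<open>S\<close>. Since the socle kills \<open>x\<close>, the product
    \<open>s \<otimes> x\<close> depends on \<open>\<pi> s\<close> only, so \<open>h\<close> induces
    a homomorphism on an ideal of \<open>R\<close>.\<close>
  have ext: "\<exists>y\<in>carrier ?W. \<forall>s\<in>carrier S. s \<otimes> x \<in> K \<longrightarrow> h (s \<otimes> x) = s \<odot>\<^bsub>?W\<^esub> y"
    if K: "ideal K S" and h: "h \<in> module_hom S (ideal_module S K) ?W" and x: "x \<in> \<nn>" for K h x
  proof -
    interpret K: ideal K S by (rule K)
    have xc: "x \<in> carrier S" by (rule S.Icarr[OF x])
    note hD = module_hom_ideal_D[OF h, simplified]
    have eq: "s \<otimes> x = s' \<otimes> x" if s: "s \<in> carrier S" "s' \<in> carrier S" "\<pi> s = \<pi> s'" for s s'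
    proof -
      have "\<pi> (s \<ominus> s') = \<zero>\<^bsub>R\<^esub>" using s by (simp add: a_minus_def R.r_neg)
      then have "(s \<ominus> s') \<otimes> x = \<zero>" using ker[of "s \<ominus> s'"] s(1,2) socle_mult x by simp
      moreover have "(s \<ominus> s') \<otimes> x = s \<otimes> x \<ominus> s' \<otimes> x"
        using s(1,2) xc by (simp add: a_minus_def S.l_distr S.l_minus)
      ultimately show ?thesis using s(1,2) xc by simp
    qed
    \<comment> \<open>An arbitrary section of \<open>\<pi>\<close>, which need not be additive; its
      product with \<open>x\<close> is linear.\<close>
    define l where "l r = inv_into (carrier S) \<pi> r" for r
    have l: "l r \<in> carrier S" "\<pi> (l r) = r" if "r \<in> carrier R" for r
      using that surj by (auto simp: l_def inv_into_into f_inv_into_f)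
    have l_add: "l (r \<oplus>\<^bsub>R\<^esub> r') \<otimes> x = l r \<otimes> x \<oplus> l r' \<otimes> x" if r: "r \<in> carrier R" "r' \<in> carrier R" for r r'
      using eq[of "l (r \<oplus>\<^bsub>R\<^esub> r')" "l r \<oplus> l r'"] l[OF r(1)] l[OF r(2)] l[of "r \<oplus>\<^bsub>R\<^esub> r'"] r xc
      by (simp add: S.l_distr)
    have l_mult: "l (r \<otimes>\<^bsub>R\<^esub> r') \<otimes> x = l r \<otimes> (l r' \<otimes> x)" if r: "r \<in> carrier R" "r' \<in> carrier R" for r r'
      using eq[of "l (r \<otimes>\<^bsub>R\<^esub> r')" "l r \<otimes> l r'"] l[OF r(1)] l[OF r(2)] l[of "r \<otimes>\<^bsub>R\<^esub> r'"] r xc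
      by (simp add: S.m_assoc)
    have l_minus: "l (\<ominus>\<^bsub>R\<^esub> r) \<otimes> x = \<ominus> (l r \<otimes> x)" if r: "r \<in> carrier R" for r
      using eq[of "l (\<ominus>\<^bsub>R\<^esub> r)" "\<ominus> l r"] l[OF r] l[of "\<ominus>\<^bsub>R\<^esub> r"] r xc
      by (simp add: S.l_minus)
    have zc: "\<zero>\<^bsub>R\<^esub> \<in> carrier R" "\<zero> \<in> carrier S"
      by (rule R.Icarr[OF R.zero_closed], rule S.Icarr[OF S.zero_closed])
    have l_zero: "l \<zero>\<^bsub>R\<^esub> \<otimes> x = \<zero>"
      using eq[of "l \<zero>\<^bsub>R\<^esub>" \<zero>] l[OF zc(1)] zc xc by simp
    let ?A = "{r \<in> carrier R. l r \<otimes> x \<in> K}"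
    have A: "ideal ?A R"
    proof (rule idealI[OF R.ring_axioms])
      show "subgroup ?A (add_monoid R)"
      proof (rule R.add.subgroupI)
        show "?A \<noteq> {}" using l_zero zc(1) K.zero_closed by auto
      qed (auto simp: l_add l_minus)
    next
      fix a r assume a: "a \<in> ?A" and r: "r \<in> carrier R"
      then show "r \<otimes>\<^bsub>R\<^esub> a \<in> ?A" using l[OF r] K.I_l_closed by (simp add: l_mult)
      then show "a \<otimes>\<^bsub>R\<^esub> r \<in> ?A" using a r by (simp add: R.m_comm)
    qed
    have "(\<lambda>r. h (l r \<otimes> x)) \<in> module_hom R (ideal_module R ?A) \<omega>"
      unfolding module_hom_ideal_iff
    proof (intro conjI ballI Pi_I)
      fix r r' assume "r \<in> ?A" "r' \<in> ?A"
      then show "h (l (r \<oplus>\<^bsub>R\<^esub> r') \<otimes> x) = h (l r \<otimes> x) \<oplus>\<^bsub>\<omega>\<^esub> h (l r' \<otimes> x)"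
        by (simp add: l_add hD(2))
    next
      fix c r assume "c \<in> carrier R" "r \<in> ?A"
      then show "h (l (c \<otimes>\<^bsub>R\<^esub> r) \<otimes> x) = c \<odot>\<^bsub>\<omega>\<^esub> h (l r \<otimes> x)"
        using l by (simp add: l_mult hD(3))
    qed (simp add: hD(1))
    then obtain y where y: "y \<in> carrier \<omega>" "\<And>r. r \<in> ?A \<Longrightarrow> h (l r \<otimes> x) = r \<odot>\<^bsub>\<omega>\<^esub> y"
      by (rule baer_injectiveD[OF baer A]) blast
    have "h (s \<otimes> x) = \<pi> s \<odot>\<^bsub>\<omega>\<^esub> y" if s: "s \<in> carrier S" "s \<otimes> x \<in> K" for s
    proof -
      have "l (\<pi> s) \<otimes> x = s \<otimes> x" using eq[of "l (\<pi> s)" s] l[of "\<pi> s"] s(1) by simp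
      then show ?thesis using y(2)[of "\<pi> s"] s by simp
    qed
    then show ?thesis using y(1) by (intro bexI[of _ y]) simp_all
  qed
  obtain h where h: "h \<in> module_hom S (ideal_module S \<nn>) ?W" and bij: "bij_betw h \<nn> (carrier ?W)"
  proof (rule S.maximal_ideal_bij_essential[OF self_injective W, of v])
    show "s \<odot>\<^bsub>?W\<^esub> y = \<zero>\<^bsub>?W\<^esub>" if "s \<in> socle S \<nn>" "y \<in> carrier ?W" for s y
      using that ker[of s] by (simp add: socle_def colon_ideal_def)
    show "r \<odot>\<^bsub>?W\<^esub> v = \<zero>\<^bsub>?W\<^esub>" if "r \<in> \<nn>" for r
      using \<mm>_v that hom_mem_maximal_iff[of r] S.Icarr[OF that] by simp
  qed (use v v0 essential ext in simp_all)
  note hD = module_hom_ideal_D[OF h, simplified]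
  define f where "f w = \<pi> (the_inv_into \<nn> h w)" for w
  have f_h: "f (h a) = \<pi> a" if "a \<in> \<nn>" for a
    using the_inv_into_f_f[OF bij_betw_imp_inj_on[OF bij] that] by (simp add: f_def)
  have h_img: "h ` \<nn> = carrier \<omega>" using bij by (simp add: bij_betw_def)
  have f: "f \<in> module_hom R \<omega> (self_module R)"
    unfolding module_hom_def
  proof (intro CollectI conjI ballI Pi_I)
    fix w assume "w \<in> carrier \<omega>"
    then obtain a where "a \<in> \<nn>" "w = h a" using h_img by blast
    then show "f w \<in> carrier (self_module R)" using f_h S.Icarr by (simp add: self_module_def)
  next
    fix w w' assume "w \<in> carrier \<omega>" "w' \<in> carrier \<omega>"
    then obtain a b where ab: "a \<in> \<nn>" "w = h a" "b \<in> \<nn>" "w' = h b" using h_img by blast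
    then have "w \<oplus>\<^bsub>\<omega>\<^esub> w' = h (a \<oplus> b)" using hD(2) by simp
    then show "f (w \<oplus>\<^bsub>\<omega>\<^esub> w') = f w \<oplus>\<^bsub>self_module R\<^esub> f w'"
      using ab f_h S.Icarr S.a_closed by (simp add: self_module_def)
  next
    fix r w assume r: "r \<in> carrier R" and "w \<in> carrier \<omega>"
    then obtain a where a: "a \<in> \<nn>" "w = h a" using h_img by blast
    obtain s where s: "s \<in> carrier S" "r = \<pi> s" using r by (rule lift)
    have "r \<odot>\<^bsub>\<omega>\<^esub> w = h (s \<otimes> a)" using hD(3)[OF s(1) a(1)] a s by simp
    then show "f (r \<odot>\<^bsub>\<omega>\<^esub> w) = r \<odot>\<^bsub>self_module R\<^esub> f w"
      using a s f_h S.Icarr S.I_l_closed by (simp add: self_module_def)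
  qed
  let ?T = "{f x |f x. f \<in> module_hom R \<omega> (self_module R) \<and> x \<in> carrier \<omega>}"
  have "?T \<subseteq> carrier R" using module_homD(1) by (fastforce simp: self_module_def)
  then have T: "?T \<subseteq> trace_ideal R \<omega>" unfolding trace_ideal_def by (rule R.genideal_self)
  show ?thesis
  proof
    fix m assume m: "m \<in> \<mm>"
    obtain s where s: "s \<in> carrier S" "m = \<pi> s" using R.Icarr[OF m] by (rule lift)
    then have "s \<in> \<nn>" using m hom_mem_maximal_iff by simp
    then have "m = f (h s)" "h s \<in> carrier \<omega>" using f_h s(2) hD(1) by simp_all
    then have "m \<in> ?T" using f by blast
    then show "m \<in> trace_ideal R \<omega>" using T by blast
  qed
qed

end

theorem corollary2p2:
  fixes R :: "('a, 'r) ring_scheme" and \<mm> :: "'a set"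
    and S :: "('b, 's) ring_scheme" and \<nn> :: "'b set"
    and \<omega> :: "('a, 'c, 'w) module_scheme"
  assumes "artinian_local_ring \<mm> R"
    and "artinian_local_ring \<nn> S"
    and "gorenstein_local_ring \<nn> S"
    and "S Quot (socle S \<nn>) \<simeq> R"
    and "is_injective_hull R (quotient_module R \<mm>) \<omega>"
  shows "\<mm> \<subseteq> trace_ideal R \<omega>
    \<and> (\<forall>xs I. system_of_parameters R \<mm> xs \<and> ideal I R \<and> Idl\<^bsub>R\<^esub> (set xs) \<subseteq> I \<longrightarrow>
         colon_ideal R (Idl\<^bsub>R\<^esub> (set xs)) (colon_ideal R (Idl\<^bsub>R\<^esub> (set xs)) I) \<subseteq> colon_ideal R I \<mm>)
    \<and> (\<forall>\<Lambda>. (\<forall>P\<in>\<Lambda>. primeideal P R \<and> P \<noteq> \<mm>)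
         \<and> (finite \<Lambda> \<or> countable \<Lambda> \<and> (adic_complete R \<mm> \<or> uncountable (carrier (R Quot \<mm>)))) \<longrightarrow>
         (\<forall>xs I. system_of_parameters R \<mm> xs \<and> (\<forall>x\<in>set xs. \<forall>P\<in>\<Lambda>. x \<notin> P)
            \<and> ideal I R \<and> Idl\<^bsub>R\<^esub> (set xs) \<subseteq> I \<longrightarrow>
            colon_ideal R (Idl\<^bsub>R\<^esub> (set xs)) (colon_ideal R (Idl\<^bsub>R\<^esub> (set xs)) I) \<subseteq> colon_ideal R I \<mm>))"
proof -
  interpret R: artinian_local_ring \<mm> R by fact
  interpret S: artinian_local_ring \<nn> S by fact
  obtain \<pi> where \<pi>: "\<pi> \<in> ring_hom S R" "\<pi> ` carrier S = carrier R"
      "\<And>x. x \<in> carrier S \<Longrightarrow> \<pi> x = \<zero>\<^bsub>R\<^esub> \<longleftrightarrow> x \<in> socle S \<nn>"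
    using quotient_iso_obtain[OF S.ring_axioms R.ring_axioms S.socle_ideal assms(4)] by blast
  have "baer_injective S (self_module S)"
    by (rule S.finite_injective_dimension_imp_baer_injective[OF S.self_module
          gorenstein_local_ring.finite_injective_dimension[OF assms(3)]])
  then interpret socle_quotient \<nn> S \<mm> R \<pi>
    by (intro socle_quotient.intro socle_quotient_axioms.intro assms \<pi>)
  \<comment> \<open>In dimension 0 the list of parameters is empty and K = 0, so conditions (2) and
    (3) both become the inclusion for annihilators.\<close>
  have colon: "colon_ideal R (Idl\<^bsub>R\<^esub> (set xs)) (colon_ideal R (Idl\<^bsub>R\<^esub> (set xs)) I) \<subseteq> colon_ideal R I \<mm>"
    if xs: "system_of_parameters R \<mm> xs" and I: "ideal I R" for xs I
  proof -
    have "xs = []" using xs R.krull_dim_eq_0 by (simp add: system_of_parameters_def zero_enat_def)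
    moreover have "Idl\<^bsub>R\<^esub> {} = {\<zero>\<^bsub>R\<^esub>}"
    proof
      show "Idl\<^bsub>R\<^esub> {} \<subseteq> {\<zero>\<^bsub>R\<^esub>}" by (rule R.genideal_minimal[OF R.zeroideal]) simp
      show "{\<zero>\<^bsub>R\<^esub>} \<subseteq> Idl\<^bsub>R\<^esub> {}"
        using R.genideal_ideal[of "{}"] additive_subgroup.zero_closed[OF ideal.axioms(1)] by blast
    qed
    ultimately show ?thesis using annihilator_annihilator_subset[OF I] by simp
  qed
  show ?thesis
    by (intro conjI allI impI maximal_ideal_subset_trace[OF assms(5)]; elim conjE; rule colon; assumption)
qed

end
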